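(* Let $\mathcal H$ be a complex separable Hilbert space and let $\rho_0\in\tilde{\mathcal B}_1^+$. Then the functional $\mathrm{QKL}(\cdot,\rho_0):\mathcal B_1\to\mathbb R\cup\{\infty\}$ is sequentially weak-$*$ lower semicompact, i.e. for every $C\in\mathbb R$ the sublevel set $\{\rho\in\mathcal B_1:\mathrm{QKL}(\rho,\rho_0)\le C\}$ is sequentially compact in the weak-$*$-topology.
   Context: $\mathcal K$ denotes the compact operators on $\mathcal H$, $\mathcal B_1$ the trace-class operators, and $\tilde{\mathcal B}_1^+$ the positive semidefinite trace-class operators. The weak-$*$-topology on $\mathcal B_1$ is the one induced by the predual $\mathcal K$ via the pairing $\langle\rho,\sigma\rangle=\operatorname{tr}(\rho\sigma)$, $\rho\in\mathcal B_1$, $\sigma\in\mathcal K$. Quantum relative entropy: $\mathrm{QKL}(\rho,\rho_0):=\infty$ if $\rho\notin\tilde{\mathcal B}_1^+$ or $\rho_0\notin\tilde{\mathcal B}_1^+$ or $\ker\rho_0\not\subseteq\ker\rho$, and otherwise $\mathrm{QKL}(\rho,\rho_0):=\operatorname{tr}(\rho_0-\rho+\rho\ln\rho-\rho\ln\rho_0)$, where $\rho\ln\rho-\rho\ln\rho_0$ is defined to be zero on $\ker\rho$. The trace is understood as a value in $[0,\infty]$ in the usual (Lindblad) sense: if $(a_i)$, $(b_j)$ are orthonormal eigenbases of $\rho,\rho_0$ with eigenvalues $\lambda_i,\mu_j$, it equals $\sum_{i,j}|\langle a_i,b_j\rangle|^2(\mu_j-\lambda_i+\lambda_i\ln\lambda_i-\lambda_i\ln\mu_j)$,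 a sum of nonnegative terms, with the conventions $0\ln 0=0$, $0\ln\mu=0$, and terms with $\langle a_i,b_j\rangle=0$ being $0$. *)

theory Defs
  imports "HOL-Analysis.Analysis"
begin

text \<open>
  Complex Hilbert spaces. The topology, norm and completeness are those of the underlying real
  Hilbert space, whose inner product is the real part of \<open>cinner\<close>; \<open>cinner\<close> is antilinear in its
  first argument.
\<close>

class complex_hilbert = real_inner + complete_space +
  fixes scaleC :: "complex \<Rightarrow> 'a \<Rightarrow> 'a"  (infixr "*\<^sub>C" 75)
    and cinner :: "'a \<Rightarrow> 'a \<Rightarrow> complex"
  assumes scaleC_add_right: "c *\<^sub>C (x + y) = c *\<^sub>C x + c *\<^sub>C y"
    and scaleC_add_left: "(c + d) *\<^sub>C x = c *\<^sub>C x + d *\<^sub>C x"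
    and scaleC_scaleC: "c *\<^sub>C d *\<^sub>C x = (c * d) *\<^sub>C x"
    and scaleC_of_real: "complex_of_real r *\<^sub>C x = r *\<^sub>R x"
    and cinner_commute: "cinner x y = cnj (cinner y x)"
    and cinner_add_right: "cinner x (y + z) = cinner x y + cinner x z"
    and cinner_scaleC_right: "cinner x (c *\<^sub>C y) = c * cinner x y"
    and Re_cinner: "Re (cinner x y) = inner x y"

text \<open>An orthonormal basis is a maximal orthonormal set.\<close>

definition is_onb :: "'a::complex_hilbert set \<Rightarrow> bool" where
  "is_onb E \<longleftrightarrow> (\<forall>e\<in>E. norm e = 1) \<and> (\<forall>e\<in>E. \<forall>f\<in>E. e \<noteq> f \<longrightarrow> cinner e f = 0) \<and>
     (\<forall>x. (\<forall>e\<in>E. cinner e x = 0) \<longrightarrow> x = 0)"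

definition some_onb :: "'a::complex_hilbert set" where
  "some_onb = (SOME E. is_onb E)"

definition bounded_clinear :: "('a::complex_hilbert \<Rightarrow> 'a) \<Rightarrow> bool" where
  "bounded_clinear A \<longleftrightarrow> bounded_linear A \<and> (\<forall>c x. A (c *\<^sub>C x) = c *\<^sub>C A x)"

definition compact_ops :: "('a::complex_hilbert \<Rightarrow> 'a) set" where
  "compact_ops = {A. bounded_clinear A \<and> compact (closure (A ` cball 0 1))}"

definition positive_op :: "('a::complex_hilbert \<Rightarrow> 'a) \<Rightarrow> bool" where
  "positive_op A \<longleftrightarrow> bounded_clinear A \<and> (\<forall>x. cinner x (A x) \<in> \<real>\<^sub>\<ge>\<^sub>0)"

definition cadjoint :: "('a::complex_hilbert \<Rightarrow> 'a) \<Rightarrow> ('a \<Rightarrow> 'a)" where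
  "cadjoint A = (THE B. \<forall>x y. cinner (A x) y = cinner x (B y))"

definition abs_op :: "('a::complex_hilbert \<Rightarrow> 'a) \<Rightarrow> ('a \<Rightarrow> 'a)" where
  "abs_op A = (THE P. positive_op P \<and> P \<circ> P = cadjoint A \<circ> A)"

text \<open>
  Neither summability of the diagonal of a positive operator nor the trace of a trace-class
  operator depends on the orthonormal basis, so both refer to one arbitrarily chosen basis.
\<close>

definition trace_class :: "('a::complex_hilbert \<Rightarrow> 'a) set" where
  "trace_class = {A. bounded_clinear A \<and> (\<lambda>e. cinner e (abs_op A e)) summable_on some_onb}"

definition tr :: "('a::complex_hilbert \<Rightarrow> 'a) \<Rightarrow> complex" where
  "tr A = (\<Sum>\<^sub>\<infinity>e\<in>some_onb. cinner e (A e))"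

definition positive_trace_class :: "('a::complex_hilbert \<Rightarrow> 'a) set" where
  "positive_trace_class = {A \<in> trace_class. positive_op A}"

text \<open>
  The initial topology on the trace class induced by the functionals \<open>\<lambda>\<rho>. tr (\<rho> \<circ> \<sigma>)\<close> with
  \<open>\<sigma>\<close> compact.
\<close>

definition weak_star :: "('a::complex_hilbert \<Rightarrow> 'a) topology" where
  "weak_star = topology_generated_by
     {{\<rho> \<in> trace_class. tr (\<rho> \<circ> \<sigma>) \<in> U} | \<sigma> U. \<sigma> \<in> compact_ops \<and> open U}"

lemma topspace_weak_star: "topspace weak_star = trace_class"
proof -
  have "(\<lambda>x::'a. 0) \<in> compact_ops"
    using scaleC_add_right[of _ "0::'a" 0] by (auto simp: compact_ops_def bounded_clinear_def image_constant_conv)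
  then have "{\<rho> \<in> trace_class. tr (\<rho> \<circ> (\<lambda>x::'a. 0)) \<in> UNIV} \<in>
      {{\<rho> \<in> trace_class. tr (\<rho> \<circ> \<sigma>) \<in> U} | \<sigma> U. \<sigma> \<in> compact_ops \<and> open U}"
    using open_UNIV by blast
  then show ?thesis
    unfolding weak_star_def topology_generated_by_topspace by auto
qed

definition seq_compactin :: "'b topology \<Rightarrow> 'b set \<Rightarrow> bool" where
  "seq_compactin X S \<longleftrightarrow> S \<subseteq> topspace X \<and>
     (\<forall>f::nat \<Rightarrow> 'b. range f \<subseteq> S \<longrightarrow>
       (\<exists>l\<in>S. \<exists>r. strict_mono r \<and> limitin X (f \<circ> r) l sequentially))"

definition seq_lower_semicompact :: "'b topology \<Rightarrow> ('b \<Rightarrow> ereal) \<Rightarrow> bool" where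
  "seq_lower_semicompact X F \<longleftrightarrow> (\<forall>C::real. seq_compactin X {x \<in> topspace X. F x \<le> ereal C})"

definition is_eigenbasis :: "('a::complex_hilbert \<Rightarrow> 'a) \<Rightarrow> 'a set \<Rightarrow> bool" where
  "is_eigenbasis A E \<longleftrightarrow> is_onb E \<and> (\<forall>e\<in>E. \<exists>c. A e = c *\<^sub>C e)"

definition some_eigenbasis :: "('a::complex_hilbert \<Rightarrow> 'a) \<Rightarrow> 'a set" where
  "some_eigenbasis A = (SOME E. is_eigenbasis A E)"

text \<open>
  For a unit eigenvector \<open>a\<close> of \<open>A\<close> with real eigenvalue, this is the eigenvalue.
\<close>

definition eigval :: "('a::complex_hilbert \<Rightarrow> 'a) \<Rightarrow> 'a \<Rightarrow> real" where
  "eigval A a = Re (cinner a (A a))"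

text \<open>
  The sum defining the relative entropy does not depend on the chosen eigenbases. Its summands are
  nonnegative reals, so that \<open>ennreal\<close> never truncates: if \<open>cinner a b \<noteq> 0\<close> and \<open>m = 0\<close>, then the
  kernel condition forces \<open>l = 0\<close>. The conventions \<open>0 ln 0 = 0\<close> and \<open>0 ln m = 0\<close>, and that
  summands with \<open>cinner a b = 0\<close> vanish, hold because \<open>ln\<close> is a total real-valued function.
\<close>

definition QKL :: "('a::complex_hilbert \<Rightarrow> 'a) \<Rightarrow> ('a \<Rightarrow> 'a) \<Rightarrow> ereal" where
  "QKL \<rho> \<rho>\<^sub>0 =
    (if \<rho> \<notin> positive_trace_class \<or> \<rho>\<^sub>0 \<notin> positive_trace_class \<or>
        \<not> {x. \<rho>\<^sub>0 x = 0} \<subseteq> {x. \<rho> x = 0}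
     then \<infinity>
     else enn2ereal (\<Sum>\<^sub>\<infinity>(a, b)\<in>some_eigenbasis \<rho> \<times> some_eigenbasis \<rho>\<^sub>0.
       let l = eigval \<rho> a; m = eigval \<rho>\<^sub>0 b
       in ennreal ((cmod (cinner a b))\<^sup>2 * (m - l + l * ln l - l * ln m))))"

lemma QKL_nonneg: "0 \<le> QKL \<rho> \<rho>\<^sub>0"
  by (simp add: QKL_def)

end

theory Submission
  imports Defs "HOL-Complex_Analysis.Great_Picard"
begin

text \<open>
  Since \<open>l \<le> (e - 1) m + (m - l + l ln l - l ln m)\<close>, a bound on the relative entropy bounds the
  trace. Positive operators of bounded trace are weakly sequentially compact by a diagonal argument,
  and weak convergence with bounded traces tests against compact operators because these are norm
  limits of finite-rank ones.

  Lower semicontinuity rests on the identity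
  \<open>1 - s + s ln s = \<integral>\<^sub>0\<^sup>\<infinity> ((s t + 1) / (1 + t)\<^sup>2 - 1 + t / (s + t)) dt\<close>, whose integrand is
  nonnegative. It writes the relative entropy as an iterated integral, over \<open>t\<close> and over an eigenbasis
  of \<open>\<rho>\<^sub>0\<close>, of affine functions of \<open>\<rho>\<close> plus multiples of \<open>\<langle>b, (\<rho> + m t)\<^sup>-\<^sup>1 b\<rangle>\<close>. The resolvent
  terms are suprema of weakly continuous functions of \<open>\<rho>\<close>, so Fatou's lemma applies.
\<close>

section \<open>Orthonormal bases\<close>

text \<open>The obstacle to lower semicontinuity is that the series in \<open>QKL\<close> runs over
  an eigenbasis of \<rho>, and neither eigenvectors nor eigenvalues along a weakly convergent
  sequence need be related to those of the limit. What does converge is the quadratic form of \<rho>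
  at fixed vectors, so the eigenbasis of \<rho> has to disappear before a limit is taken. Resolvents
  achieve this: they are the only nonlinear functions of \<rho> in the integral representation, and
  their variational formula mentions nothing but the quadratic form. The eigenbasis of
  \<open>\<rho>\<^sub>0\<close> is fixed and may stay. The eigenvalue 0 of
  \<open>\<rho>\<^sub>0\<close> is out of reach of the identity, where s = l / m; there the kernel
  condition takes over, which itself survives weak limits.

  Several notions select their objects by \<open>SOME\<close> and \<open>THE\<close>. Hence
  existence of eigenbases, uniqueness of positive square roots and independence of trace bounds from
  the basis have to be established along the way.\<close>

lemma cinner_add_left: "cinner (x + y) z = cinner x z + cinner y z"
  by (metis cinner_add_right cinner_commute complex_cnj_add)

lemma cinner_scaleC_left: "cinner (c *\<^sub>C x) y = cnj c * cinner x y"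
  by (metis cinner_commute cinner_scaleC_right complex_cnj_mult)

lemma cinner_self: "cinner x x = complex_of_real ((norm x)\<^sup>2)"
proof -
  have "Im (cinner x x) = 0"
    using cinner_commute[of x x] by (metis cnj.simps(2) equal_neg_zero)
  then show ?thesis
    by (simp add: complex_eq_iff Re_cinner power2_norm_eq_inner)
qed

lemma norm_scaleC: "norm (c *\<^sub>C x) = cmod c * norm x"
proof -
  have "cinner (c *\<^sub>C x) (c *\<^sub>C x) = (c * cnj c) * cinner x x"
    by (simp add: cinner_scaleC_left cinner_scaleC_right)
  then have "(norm (c *\<^sub>C x))\<^sup>2 = (cmod c)\<^sup>2 * (norm x)\<^sup>2"
    unfolding cinner_self complex_norm_square[symmetric] of_real_mult[symmetric] of_real_eq_iff .
  then show ?thesis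
    by (simp add: power2_eq_imp_eq power_mult_distrib)
qed

text \<open>Rotating an argument by such a phase makes \<open>cinner\<close> real and nonnegative,
  so bounds for the real \<open>inner\<close> transfer to \<open>cmod (cinner x y)\<close>.\<close>

lemma exists_phase: "\<exists>u::complex. cmod u = 1 \<and> u * z = complex_of_real (cmod z)"
proof (cases "z = 0")
  case True then show ?thesis by (intro exI[of _ 1]) auto
next
  case False
  have "cnj z * z = complex_of_real ((cmod z)\<^sup>2)"
    by (metis complex_norm_square mult.commute)
  then have "cnj z / cmod z * z = cmod z"
    using False by (simp add: power2_eq_square field_simps)
  then show ?thesis using False
    by (intro exI[of _ "cnj z / cmod z"]) (auto simp: norm_divide)
qed

lemma cmod_cinner_le: "cmod (cinner x y) \<le> norm x * norm y"
proof -
  obtain u where u: "cmod u = 1" "u * cinner x y = complex_of_real (cmod (cinner x y))"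
    using exists_phase[of "cinner x y"] by blast
  have "cmod (cinner x y) = inner x (u *\<^sub>C y)"
    unfolding Re_cinner[symmetric] cinner_scaleC_right u(2) by simp
  also have "\<dots> \<le> norm x * norm (u *\<^sub>C y)" by (rule norm_cauchy_schwarz)
  finally show ?thesis using u(1) by (simp add: norm_scaleC)
qed

lemma bounded_bilinear_cinner: "bounded_bilinear (cinner :: 'a::complex_hilbert \<Rightarrow> 'a \<Rightarrow> complex)"
proof
  fix a a' b b' :: 'a and r :: real
  show "cinner (a + a') b = cinner a b + cinner a' b" by (rule cinner_add_left)
  show "cinner a (b + b') = cinner a b + cinner a b'" by (rule cinner_add_right)
  show "cinner (r *\<^sub>R a) b = r *\<^sub>R cinner a b"
    by (simp add: scaleC_of_real[symmetric] cinner_scaleC_left scaleR_conv_of_real)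
  show "cinner a (r *\<^sub>R b) = r *\<^sub>R cinner a b"
    by (simp add: scaleC_of_real[symmetric] cinner_scaleC_right scaleR_conv_of_real)
  show "\<exists>K. \<forall>a b::'a. cmod (cinner a b) \<le> norm a * norm b * K"
    by (intro exI[of _ 1]) (simp add: cmod_cinner_le)
qed

lemma bounded_bilinear_scaleC: "bounded_bilinear (scaleC :: complex \<Rightarrow> 'a::complex_hilbert \<Rightarrow> 'a)"
proof
  fix a a' :: complex and b b' :: 'a and r :: real
  show "(a + a') *\<^sub>C b = a *\<^sub>C b + a' *\<^sub>C b" by (rule scaleC_add_left)
  show "a *\<^sub>C (b + b') = a *\<^sub>C b + a *\<^sub>C b'" by (rule scaleC_add_right)
  show "(r *\<^sub>R a) *\<^sub>C b = r *\<^sub>R (a *\<^sub>C b)"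
    by (simp add: scaleC_of_real[symmetric] scaleC_scaleC scaleR_conv_of_real)
  show "a *\<^sub>C (r *\<^sub>R b) = r *\<^sub>R (a *\<^sub>C b)"
    by (simp add: scaleC_of_real[symmetric] scaleC_scaleC mult.commute)
  show "\<exists>K. \<forall>a (b::'a). norm (a *\<^sub>C b) \<le> norm a * norm b * K"
    by (intro exI[of _ 1]) (simp add: norm_scaleC)
qed

global_interpretation cinner: bounded_bilinear "cinner :: 'a::complex_hilbert \<Rightarrow> 'a \<Rightarrow> complex"
  by (rule bounded_bilinear_cinner)

global_interpretation scaleC: bounded_bilinear "scaleC :: complex \<Rightarrow> 'a::complex_hilbert \<Rightarrow> 'a"
  by (rule bounded_bilinear_scaleC)

lemma cinner_eq_zero_iff: "cinner x x = 0 \<longleftrightarrow> x = 0"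
  by (simp add: cinner_self)

lemma cinner_ext:
  assumes "\<And>x. cinner x y = cinner x z" shows "y = z"
  using assms[of "y - z"] cinner_eq_zero_iff[of "y - z"] by (simp add: cinner.diff_right)

lemma cmod_cinner_commute: "cmod (cinner x y) = cmod (cinner y x)"
  by (metis cinner_commute complex_mod_cnj)

definition orthonormal :: "'a::complex_hilbert set \<Rightarrow> bool" where
  "orthonormal E \<longleftrightarrow> (\<forall>e\<in>E. norm e = 1) \<and> (\<forall>e\<in>E. \<forall>f\<in>E. e \<noteq> f \<longrightarrow> cinner e f = 0)"

lemma is_onb_iff:
  "is_onb E \<longleftrightarrow> orthonormal E \<and> (\<forall>x. (\<forall>e\<in>E. cinner e x = 0) \<longrightarrow> x = 0)"
  by (auto simp: is_onb_def orthonormal_def)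

lemma orthonormal_cinner:
  "orthonormal E \<Longrightarrow> e \<in> E \<Longrightarrow> f \<in> E \<Longrightarrow> cinner e f = (if e = f then 1 else 0)"
  by (auto simp: orthonormal_def cinner_self)

text \<open>Zorn's lemma. The predicate lets one argument serve twice: trivial \<open>P\<close>
  yields an orthonormal basis, \<open>P\<close> for eigenvectors the starting point of
  diagonalization.\<close>

lemma maximal_orthonormal:
  "\<exists>E. orthonormal E \<and> (\<forall>e\<in>E. P e) \<and> (\<forall>x. norm x = 1 \<longrightarrow> P x \<longrightarrow> (\<exists>e\<in>E. cinner e x \<noteq> 0))"
proof -
  define \<A> where "\<A> = {E. orthonormal E \<and> (\<forall>e\<in>E. P e)}"
  have "\<exists>M\<in>\<A>. \<forall>X\<in>\<A>. M \<subseteq> X \<longrightarrow> X = M"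
  proof (rule subset_Zorn')
    fix C assume C: "subset.chain \<A> C"
    then have sub: "C \<subseteq> \<A>" and ch: "\<And>X Y. X \<in> C \<Longrightarrow> Y \<in> C \<Longrightarrow> X \<subseteq> Y \<or> Y \<subseteq> X"
      by (auto simp: subset_chain_def)
    have "cinner e f = 0" if e: "e \<in> X" "X \<in> C" and f: "f \<in> Y" "Y \<in> C" and "e \<noteq> f" for e f X Y
    proof -
      obtain Z where "Z \<in> C" "e \<in> Z" "f \<in> Z" using ch[OF e(2) f(2)] e f by blast
      then show ?thesis using sub \<open>e \<noteq> f\<close> by (auto simp: \<A>_def orthonormal_def)
    qed
    moreover have "norm e = 1" "P e" if "e \<in> X" "X \<in> C" for e X
      using sub that by (auto simp: \<A>_def orthonormal_def)
    ultimately show "\<Union>C \<in> \<A>"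
      unfolding \<A>_def orthonormal_def by blast
  qed
  then obtain M where M: "M \<in> \<A>" and max: "\<And>X. X \<in> \<A> \<Longrightarrow> M \<subseteq> X \<Longrightarrow> X = M" by blast
  have "\<exists>e\<in>M. cinner e x \<noteq> 0" if "norm x = 1" "P x" for x
  proof (rule ccontr)
    assume "\<not> ?thesis"
    then have z: "cinner e x = 0" "cinner x e = 0" if "e \<in> M" for e
      using that cinner_commute[of x e] by auto
    have "insert x M \<in> \<A>"
      using M z that by (auto simp: \<A>_def orthonormal_def)
    then have "x \<in> M" using max by blast
    then show False using z(1)[of x] that by (auto simp: cinner_self)
  qed
  then show ?thesis using M by (auto simp: \<A>_def)
qed

lemma exists_onb: "\<exists>E::'a::complex_hilbert set. is_onb E"
proof -
  obtain E :: "'a set" where E: "orthonormal E" and m: "\<And>x. norm x = 1 \<Longrightarrow> \<exists>e\<in>E. cinner e x \<noteq> 0"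
    using maximal_orthonormal[where P="\<lambda>_. True"] by blast
  have "x = 0" if "\<forall>e\<in>E. cinner e x = 0" for x
  proof (rule ccontr)
    assume "x \<noteq> 0"
    then obtain e where "e \<in> E" "cinner e (x /\<^sub>R norm x) \<noteq> 0"
      using m[of "x /\<^sub>R norm x"] by auto
    then show False using that by (simp add: cinner.scaleR_right)
  qed
  then show ?thesis using E by (auto simp: is_onb_iff)
qed

lemma is_onb_some_onb: "is_onb some_onb"
  unfolding some_onb_def using exists_onb by (rule someI_ex)

text \<open>Distinct orthonormal vectors are at distance sqrt 2 > 1, so sending each to a point of
  \<open>D\<close> closer than 1/2 is injective.\<close>

lemma countable_orthonormal:
  fixes E :: "'a::complex_hilbert set"
  assumes "countable D" and D: "closure D = (UNIV :: 'a set)" and E: "orthonormal E"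
  shows "countable E"
proof -
  have "\<forall>e. \<exists>d\<in>D. dist d e < 1/2"
    using D closure_approachable[of _ D] by (metis UNIV_I half_gt_zero_iff zero_less_one)
  then obtain d where d: "\<And>e. d e \<in> D" "\<And>e. dist (d e) e < 1/2" by metis
  have "inj_on d E"
  proof (rule inj_onI, rule ccontr)
    fix e f assume ef: "e \<in> E" "f \<in> E" "d e = d f" "e \<noteq> f"
    have "dist e f < 1"
      using d(2)[of e] d(2)[of f] ef(3) dist_triangle_half_r by metis
    then have "norm (e - f) < 1" by (simp add: dist_norm)
    moreover have "complex_of_real ((norm (e - f))\<^sup>2) = 2"
      unfolding cinner_self[symmetric]
      using ef orthonormal_cinner[OF E] by (simp add: cinner.diff_left cinner.diff_right)
    then have "(norm (e - f))\<^sup>2 = 2"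
      by (metis of_real_eq_iff of_real_numeral)
    ultimately show False
      using power_mono[of "norm (e - f)" 1 2] by simp
  qed
  then show ?thesis
    using \<open>countable D\<close> d(1) by (meson countable_image_inj_on countable_subset image_subsetI)
qed

section \<open>Orthonormal expansions: Bessel, Riesz-Fischer and Parseval\<close>

lemma cinner_orthonormal_sum:
  assumes "orthonormal E" "finite F" "F \<subseteq> E" "e \<in> E"
  shows "cinner e (\<Sum>f\<in>F. c f *\<^sub>C f) = (if e \<in> F then c e else 0)"
proof -
  have "c f * cinner e f = (if f = e then c f else 0)" if "f \<in> F" for f
    using that assms by (simp add: orthonormal_cinner[OF assms(1)] subset_iff)
  then have "cinner e (\<Sum>f\<in>F. c f *\<^sub>C f) = (\<Sum>f\<in>F. if f = e then c f else 0)"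
    by (simp add: cinner.sum_right cinner_scaleC_right)
  then show ?thesis using assms by simp
qed

lemma norm_orthonormal_sum:
  assumes "orthonormal E" "finite F" "F \<subseteq> E"
  shows "(norm (\<Sum>f\<in>F. c f *\<^sub>C f))\<^sup>2 = (\<Sum>f\<in>F. (cmod (c f))\<^sup>2)"
proof -
  have "complex_of_real ((norm (\<Sum>f\<in>F. c f *\<^sub>C f))\<^sup>2) = (\<Sum>e\<in>F. cnj (c e) * c e)"
    unfolding cinner_self[symmetric] cinner.sum_left cinner_scaleC_left
    using assms by (intro sum.cong refl) (simp add: cinner_orthonormal_sum[OF assms] subset_iff)
  also have "\<dots> = complex_of_real (\<Sum>f\<in>F. (cmod (c f))\<^sup>2)"
    unfolding of_real_sum by (intro sum.cong refl) (metis complex_norm_square mult.commute)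
  finally show ?thesis using of_real_eq_iff by blast
qed

lemma norm_diff_projection:
  assumes "orthonormal E" "finite F" "F \<subseteq> E"
  shows "(norm (x - (\<Sum>f\<in>F. cinner f x *\<^sub>C f)))\<^sup>2 = (norm x)\<^sup>2 - (\<Sum>f\<in>F. (cmod (cinner f x))\<^sup>2)"
proof -
  let ?p = "\<Sum>f\<in>F. cinner f x *\<^sub>C f"
  have "cinner ?p x = complex_of_real (\<Sum>f\<in>F. (cmod (cinner f x))\<^sup>2)"
    unfolding cinner.sum_left of_real_sum cinner_scaleC_left
    by (intro sum.cong refl) (metis complex_norm_square mult.commute)
  then have "inner ?p x = (\<Sum>f\<in>F. (cmod (cinner f x))\<^sup>2)"
    by (metis Re_cinner Re_complex_of_real)
  then show ?thesis
    using norm_orthonormal_sum[OF assms, of "\<lambda>f. cinner f x"]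
    by (simp add: power2_norm_eq_inner inner_diff_left inner_diff_right inner_commute)
qed

lemma bessel:
  assumes "orthonormal E" "finite F" "F \<subseteq> E"
  shows "(\<Sum>f\<in>F. (cmod (cinner f x))\<^sup>2) \<le> (norm x)\<^sup>2"
  using norm_diff_projection[OF assms, of x] zero_le_power2[of "norm (x - (\<Sum>f\<in>F. cinner f x *\<^sub>C f))"]
  by linarith

lemma norm_diff_projection_le:
  assumes "orthonormal E" "finite F" "F \<subseteq> E"
  shows "norm (x - (\<Sum>f\<in>F. cinner f x *\<^sub>C f)) \<le> norm x"
  by (rule power2_le_imp_le)
    (use norm_diff_projection[OF assms, of x] in \<open>auto intro: sum_nonneg\<close>)

lemma norm_diff_projection_mono:
  assumes "orthonormal E" "finite F" "F \<subseteq> E" "G \<subseteq> F"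
  shows "norm (x - (\<Sum>f\<in>F. cinner f x *\<^sub>C f)) \<le> norm (x - (\<Sum>f\<in>G. cinner f x *\<^sub>C f))"
proof (rule power2_le_imp_le)
  show "(norm (x - (\<Sum>f\<in>F. cinner f x *\<^sub>C f)))\<^sup>2 \<le> (norm (x - (\<Sum>f\<in>G. cinner f x *\<^sub>C f)))\<^sup>2"
    using norm_diff_projection[OF assms(1-3), of x]
      norm_diff_projection[OF assms(1) finite_subset[OF assms(4,2)], of x] assms
      sum_mono2[OF assms(2,4), of "\<lambda>f. (cmod (cinner f x))\<^sup>2"]
    by auto
qed simp

text \<open>Riesz-Fischer. The vector series need not converge absolutely, so the Cauchy property of
  the net of finite partial sums is used: by Pythagoras, their differences are governed by tails of
  the scalar series of squares.\<close>

lemma orthonormal_has_sum: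
  fixes E :: "'a::complex_hilbert set"
  assumes E: "orthonormal E"
    and bound: "\<And>F. finite F \<Longrightarrow> F \<subseteq> E \<Longrightarrow> (\<Sum>f\<in>F. (cmod (c f))\<^sup>2) \<le> B"
  obtains x where "((\<lambda>e. c e *\<^sub>C e) has_sum x) E" "\<And>e. e \<in> E \<Longrightarrow> cinner e x = c e"
proof -
  let ?g = "\<lambda>e. (cmod (c e))\<^sup>2" and ?f = "\<lambda>e. c e *\<^sub>C e"
  have "?g summable_on E"
    by (rule nonneg_bdd_above_summable_on) (auto intro!: bdd_aboveI[of _ B] bound)
  then obtain L where lim: "(sum ?g \<longlongrightarrow> L) (finite_subsets_at_top E)"
    by (auto simp: summable_on_def has_sum_def)
  have "\<exists>P. eventually P (finite_subsets_at_top E) \<and>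
              (\<forall>F F'. P F \<and> P F' \<longrightarrow> dist (sum ?f F) (sum ?f F') < e)" if "e > 0" for e
  proof -
    \<comment> \<open>Two deviations below (e/2)^2 / 2 add up to less than (e/2)^2, the square of
      the distance wanted.\<close>
    have "eventually (\<lambda>F. dist (sum ?g F) L < (e/2)\<^sup>2 / 2) (finite_subsets_at_top E)"
      by (rule tendstoD[OF lim]) (use that in simp)
    then obtain F0 where F0: "finite F0" "F0 \<subseteq> E"
      and d: "\<And>F. finite F \<Longrightarrow> F0 \<subseteq> F \<Longrightarrow> F \<subseteq> E \<Longrightarrow> dist (sum ?g F) L < (e/2)\<^sup>2 / 2"
      by (auto simp: eventually_finite_subsets_at_top)
    define P where "P F \<longleftrightarrow> finite F \<and> F0 \<subseteq> F \<and> F \<subseteq> E" for F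
    have near: "dist (sum ?f F) (sum ?f F0) < e/2" if "P F" for F
    proof -
      have "(dist (sum ?f F) (sum ?f F0))\<^sup>2 = (norm (sum ?f (F - F0)))\<^sup>2"
        using that by (simp add: dist_norm P_def sum_diff)
      also have "\<dots> = sum ?g (F - F0)"
        using that by (intro norm_orthonormal_sum[OF E]) (auto simp: P_def)
      also have "\<dots> = sum ?g F - sum ?g F0"
        using that by (simp add: P_def sum_diff)
      also have "\<dots> < (e/2)\<^sup>2"
      proof -
        have "\<bar>sum ?g F - L\<bar> < (e/2)\<^sup>2 / 2" "\<bar>sum ?g F0 - L\<bar> < (e/2)\<^sup>2 / 2"
          using d[of F] d[of F0] that F0 by (auto simp: P_def dist_real_def)
        then show ?thesis by linarith
      qed
      finally show ?thesis
        using \<open>e > 0\<close> by (auto dest: power2_less_imp_less)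
    qed
    have "eventually P (finite_subsets_at_top E)"
      using F0 by (auto simp: P_def eventually_finite_subsets_at_top)
    moreover have "dist (sum ?f F) (sum ?f F') < e" if "P F" "P F'" for F F'
      using dist_triangle_half_l[OF near[OF that(1)] near[OF that(2)]] .
    ultimately show ?thesis by blast
  qed
  then have "cauchy_filter (filtermap (sum ?f) (finite_subsets_at_top E))"
    by (simp add: cauchy_filter_metric_filtermap)
  moreover have "complete (UNIV::'a set)"
    by (rule complete_UNIV)
  ultimately obtain x where "(sum ?f \<longlongrightarrow> x) (finite_subsets_at_top E)"
    using complete_uniform[where S=UNIV] by (force simp add: filterlim_def)
  then have x: "(?f has_sum x) E" by (simp add: has_sum_def)
  have "cinner e x = c e" if "e \<in> E" for e
  proof -
    have "((\<lambda>f. cinner e (?f f)) has_sum cinner e x) E"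
      by (rule has_sum_bounded_linear[OF cinner.bounded_linear_right x])
    moreover have "((\<lambda>f. cinner e (?f f)) has_sum c e) E"
    proof (rule has_sum_cong_neutral[where S="{e}", THEN iffD1])
      show "cinner e (c f *\<^sub>C f) = 0" if "f \<in> E - {e}" for f
        using that \<open>e \<in> E\<close> by (auto simp: cinner_scaleC_right orthonormal_cinner[OF E])
      show "((\<lambda>f. cinner e (c f *\<^sub>C f)) has_sum c e) {e}"
        using \<open>e \<in> E\<close> by (simp add: has_sum_finite_iff cinner_scaleC_right orthonormal_cinner[OF E])
    qed (use that in auto)
    ultimately show ?thesis by (rule has_sum_unique)
  qed
  then show thesis using that x by blast
qed

lemma onb_has_sum:
  assumes "is_onb E" shows "((\<lambda>e. cinner e x *\<^sub>C e) has_sum x) E"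
proof -
  have E: "orthonormal E" using assms by (simp add: is_onb_iff)
  obtain y where y: "((\<lambda>e. cinner e x *\<^sub>C e) has_sum y) E" "\<And>e. e \<in> E \<Longrightarrow> cinner e y = cinner e x"
    using orthonormal_has_sum[OF E bessel[OF E]] by blast
  have "\<forall>e\<in>E. cinner e (y - x) = 0" using y(2) by (simp add: cinner.diff_right)
  then have "y - x = 0" using assms unfolding is_onb_iff by blast
  then show ?thesis using y by simp
qed

lemma parseval_cinner:
  assumes "is_onb E" shows "((\<lambda>e. cinner x e * cinner e y) has_sum cinner x y) E"
  using has_sum_bounded_linear[OF cinner.bounded_linear_right onb_has_sum[OF assms, of y], of x]
  by (simp add: cinner_scaleC_right mult.commute)

lemma parseval:
  assumes "is_onb E" shows "((\<lambda>e. (cmod (cinner e x))\<^sup>2) has_sum (norm x)\<^sup>2) E"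
proof -
  have "cinner x e * cinner e x = complex_of_real ((cmod (cinner e x))\<^sup>2)" for e
    using complex_norm_square[of "cinner e x"] cinner_commute[of x e] by (simp add: mult.commute)
  then have "((\<lambda>e. complex_of_real ((cmod (cinner e x))\<^sup>2)) has_sum complex_of_real ((norm x)\<^sup>2)) E"
    using parseval_cinner[OF assms, of x x] by (simp add: cinner_self)
  then show ?thesis using has_sum_of_real_iff by blast
qed

text \<open>An exchange of limits, applied to truncations: of a test vector in
  \<open>weak_limit\<close> and of a compact operator in \<open>tr_tendsto\<close>.\<close>

lemma tendsto_uniform_approx:
  fixes a :: "nat \<Rightarrow> 'b::real_normed_vector"
  assumes "\<And>\<epsilon>. \<epsilon> > 0 \<Longrightarrow> \<exists>b m. b \<longlonglongrightarrow> m \<and> (\<forall>n. norm (a n - b n) \<le> \<epsilon>) \<and> norm (l - m) \<le> \<epsilon>"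
  shows "a \<longlonglongrightarrow> l"
proof (rule tendstoI)
  fix e :: real assume "e > 0"
  then obtain b m where bm: "b \<longlonglongrightarrow> m" "\<And>n. norm (a n - b n) \<le> e/4" "norm (l - m) \<le> e/4"
    using assms[of "e/4"] by auto
  have "eventually (\<lambda>n. dist (b n) m < e/4) sequentially"
    by (rule tendstoD[OF bm(1)]) (use \<open>e > 0\<close> in simp)
  then show "eventually (\<lambda>n. dist (a n) l < e) sequentially"
  proof eventually_elim
    case (elim n)
    have "norm ((a n - b n) + ((b n - m) - (l - m))) \<le> norm (a n - b n) + (norm (b n - m) + norm (l - m))"
      by (meson norm_triangle_ineq norm_triangle_ineq4 add_left_mono order_trans)
    then show ?case
      using elim bm(2)[of n] bm(3) \<open>e > 0\<close> by (simp add: dist_norm)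
  qed
qed

lemma onb_approx:
  assumes "is_onb E" "\<epsilon> > 0"
  obtains F where "finite F" "F \<subseteq> E" "norm (x - (\<Sum>f\<in>F. cinner f x *\<^sub>C f)) < \<epsilon>"
proof -
  have "eventually (\<lambda>F. dist (\<Sum>f\<in>F. cinner f x *\<^sub>C f) x < \<epsilon>) (finite_subsets_at_top E)"
    using onb_has_sum[OF assms(1), of x] assms(2) unfolding has_sum_def by (rule tendstoD)
  then show thesis
    using that by (auto simp: eventually_finite_subsets_at_top dist_norm norm_minus_commute)
qed

text \<open>Bessel's inequality passes to the limit coefficients, so Riesz-Fischer assembles them
  into \<open>z\<close>. The uniform norm bound then extends convergence from basis vectors to all
  test vectors.\<close>

lemma weak_limit:
  fixes y :: "nat \<Rightarrow> 'a::complex_hilbert"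
  assumes E: "is_onb E" and M: "\<And>n. norm (y n) \<le> M"
    and conv: "\<And>e. e \<in> E \<Longrightarrow> convergent (\<lambda>n. cinner e (y n))"
  obtains z where "norm z \<le> M" "\<And>x. (\<lambda>n. cinner x (y n)) \<longlonglongrightarrow> cinner x z"
proof -
  have on: "orthonormal E" using E by (simp add: is_onb_iff)
  have M0: "M \<ge> 0" using M[of 0] norm_ge_zero order_trans by blast
  define c where "c e = lim (\<lambda>n. cinner e (y n))" for e
  have c: "(\<lambda>n. cinner e (y n)) \<longlonglongrightarrow> c e" if "e \<in> E" for e
    using conv[OF that] by (simp add: c_def convergent_LIMSEQ_iff)
  have bound: "(\<Sum>e\<in>F. (cmod (c e))\<^sup>2) \<le> M\<^sup>2" if F: "finite F" "F \<subseteq> E" for F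
  proof (rule LIMSEQ_le_const2)
    show "(\<lambda>n. \<Sum>e\<in>F. (cmod (cinner e (y n)))\<^sup>2) \<longlonglongrightarrow> (\<Sum>e\<in>F. (cmod (c e))\<^sup>2)"
      using F by (intro tendsto_intros c) auto
    have "(\<Sum>e\<in>F. (cmod (cinner e (y n)))\<^sup>2) \<le> M\<^sup>2" for n
      using bessel[OF on F, of "y n"] power_mono[OF M[of n], of 2] by simp
    then show "\<exists>N. \<forall>n\<ge>N. (\<Sum>e\<in>F. (cmod (cinner e (y n)))\<^sup>2) \<le> M\<^sup>2" by blast
  qed
  obtain z where z: "((\<lambda>e. c e *\<^sub>C e) has_sum z) E" "\<And>e. e \<in> E \<Longrightarrow> cinner e z = c e"
    using orthonormal_has_sum[OF on bound] by metis
  have "(norm z)\<^sup>2 \<le> M\<^sup>2"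
  proof (rule has_sum_le_finite_sums[OF parseval[OF E]])
    show "(\<Sum>e\<in>F. (cmod (cinner e z))\<^sup>2) \<le> M\<^sup>2" if "finite F" "F \<subseteq> E" for F
      using bound[OF that] that z(2) by (simp add: subset_iff)
  qed
  then have nz: "norm z \<le> M" using M0 power2_le_imp_le by blast
  have "(\<lambda>n. cinner x (y n)) \<longlonglongrightarrow> cinner x z" for x
  proof (rule tendsto_uniform_approx)
    fix \<epsilon> :: real assume "\<epsilon> > 0"
    \<comment> \<open>The summand 1 covers \<open>M = 0\<close>.\<close>
    then have "\<epsilon> / (M + 1) > 0" using M0 by simp
    then obtain F where F: "finite F" "F \<subseteq> E"
      and d: "norm (x - (\<Sum>f\<in>F. cinner f x *\<^sub>C f)) < \<epsilon> / (M + 1)"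
      using onb_approx[OF E] by metis
    let ?p = "\<Sum>f\<in>F. cinner f x *\<^sub>C f"
    have small: "cmod (cinner x w - cinner ?p w) \<le> \<epsilon>" if "norm w \<le> M" for w
    proof -
      have "cmod (cinner x w - cinner ?p w) \<le> norm (x - ?p) * norm w"
        unfolding cinner.diff_left[symmetric] by (rule cmod_cinner_le)
      also have "\<dots> \<le> \<epsilon> / (M + 1) * (M + 1)"
        using d that M0 \<open>\<epsilon> > 0\<close> by (intro mult_mono) auto
      finally show ?thesis using M0 by simp
    qed
    have "(\<lambda>n. cinner ?p (y n)) \<longlonglongrightarrow> cinner ?p z"
      unfolding cinner.sum_left cinner_scaleC_left
      using F c z(2) by (intro tendsto_intros) (auto simp: subset_iff)
    then show "\<exists>b m. b \<longlonglongrightarrow> m \<and> (\<forall>n. cmod (cinner x (y n) - b n) \<le> \<epsilon>) \<and> cmod (cinner x z - m) \<le> \<epsilon>"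
      using small M nz by blast
  qed
  then show thesis using that nz by blast
qed

text \<open>The representing vector must have the coefficients \<open>cnj (\<phi> e)\<close>. They
  are square-summable because on a finite partial sum v of the expected vector, \<phi> takes the
  value (norm v)^2, which is at most K times norm v.\<close>

lemma riesz_representation:
  fixes \<phi> :: "'a::complex_hilbert \<Rightarrow> complex"
  assumes bl: "bounded_linear \<phi>" and hom: "\<And>c x. \<phi> (c *\<^sub>C x) = c * \<phi> x"
  obtains w where "\<And>x. \<phi> x = cinner w x"
proof -
  obtain E :: "'a set" where E: "is_onb E" using exists_onb by blast
  then have on: "orthonormal E" by (simp add: is_onb_iff)
  interpret \<phi>: bounded_linear \<phi> by (rule bl)
  obtain K where K: "K > 0" "\<And>x. cmod (\<phi> x) \<le> norm x * K" using \<phi>.pos_bounded by blast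
  have bound: "(\<Sum>e\<in>F. (cmod (cnj (\<phi> e)))\<^sup>2) \<le> K\<^sup>2" if F: "finite F" "F \<subseteq> E" for F
  proof -
    let ?s = "\<Sum>e\<in>F. (cmod (cnj (\<phi> e)))\<^sup>2" and ?v = "\<Sum>e\<in>F. cnj (\<phi> e) *\<^sub>C e"
    have "\<phi> ?v = complex_of_real ?s"
      unfolding \<phi>.sum hom of_real_sum
      by (intro sum.cong refl) (metis complex_cnj_cnj complex_mod_cnj complex_norm_square)
    moreover have "\<bar>?s\<bar> = ?s" by (simp add: sum_nonneg)
    ultimately have "?s \<le> norm ?v * K"
      using K(2)[of ?v] by (metis norm_of_real)
    moreover have "?s = (norm ?v)\<^sup>2"
      using norm_orthonormal_sum[OF on F, of "\<lambda>e. cnj (\<phi> e)"] by simp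
    ultimately have "norm ?v \<le> K"
      using K(1) by (cases "norm ?v = 0") (auto simp: power2_eq_square)
    then show ?thesis using \<open>?s = (norm ?v)\<^sup>2\<close> power_mono[of "norm ?v" K 2] by simp
  qed
  obtain w where w: "\<And>e. e \<in> E \<Longrightarrow> cinner e w = cnj (\<phi> e)"
    using orthonormal_has_sum[OF on bound] by metis
  have "\<phi> x = cinner w x" for x
  proof -
    have "((\<lambda>e. \<phi> (cinner e x *\<^sub>C e)) has_sum \<phi> x) E"
      by (rule has_sum_bounded_linear[OF bl onb_has_sum[OF E]])
    moreover have "\<phi> (cinner e x *\<^sub>C e) = cinner w e * cinner e x" if "e \<in> E" for e
      using w[OF that] cinner_commute[of w e] by (simp add: hom)
    then have "((\<lambda>e. \<phi> (cinner e x *\<^sub>C e)) has_sum cinner w x) E"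
      using parseval_cinner[OF E, of w x] by (simp cong: has_sum_cong)
    ultimately show ?thesis by (rule has_sum_unique)
  qed
  then show thesis using that by blast
qed

section \<open>Positive operators\<close>

lemma positive_op_bounded_linear: "positive_op A \<Longrightarrow> bounded_linear A"
  by (simp add: positive_op_def bounded_clinear_def)

lemma positive_op_scaleC: "positive_op A \<Longrightarrow> A (c *\<^sub>C x) = c *\<^sub>C A x"
  by (simp add: positive_op_def bounded_clinear_def)

text \<open>From here on \<open>eigval A x\<close> serves, for arbitrary \<open>x\<close>, as the
  quadratic form of \<open>A\<close>; it is an eigenvalue only at unit eigenvectors.\<close>

lemma cinner_eigval:
  assumes "positive_op A" shows "cinner x (A x) = complex_of_real (eigval A x)"
  using assms unfolding positive_op_def eigval_def
  by (metis complex_is_Real_iff nonneg_Reals_subset_Reals of_real_Re subsetD)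

lemma eigval_nonneg: "positive_op A \<Longrightarrow> eigval A x \<ge> 0"
  using complex_nonneg_Reals_iff unfolding positive_op_def eigval_def by blast

lemma positive_opI:
  assumes "bounded_clinear A" "\<And>x. Im (cinner x (A x)) = 0" "\<And>x. eigval A x \<ge> 0"
  shows "positive_op A"
  using assms by (auto simp: positive_op_def eigval_def complex_nonneg_Reals_iff)

text \<open>Polarization: the defect \<open>s\<close> vanishes on the diagonal and is therefore
  antisymmetric; replacing y by i y makes it symmetric as well, hence zero.\<close>

lemma positive_op_symmetric:
  assumes A: "positive_op A" shows "cinner (A x) y = cinner x (A y)"
proof -
  interpret A: bounded_linear A using A by (rule positive_op_bounded_linear)
  define s where "s x y = cinner x (A y) - cinner (A x) y" for x y
  have s0: "s x x = 0" for x
    using cinner_eigval[OF A, of x] cinner_commute[of "A x" x] by (simp add: s_def)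
  have add: "s x y + s y x = 0" for x y
    using s0[of "x + y"] s0[of x] s0[of y]
    by (simp add: s_def A.add cinner_add_left cinner_add_right algebra_simps)
  have "s x (\<i> *\<^sub>C y) = \<i> * s x y" "s (\<i> *\<^sub>C y) x = - \<i> * s y x" for x y
    by (simp_all add: s_def positive_op_scaleC[OF A] cinner_scaleC_left cinner_scaleC_right algebra_simps)
  then have "\<i> * (s x y - s y x) = 0" for x y
    using add[of x "\<i> *\<^sub>C y"] by (simp add: algebra_simps)
  then have "s x y = s y x" for x y by simp
  then have "2 * s x y = 0" using add[of x y] by (metis mult_2)
  then show ?thesis by (simp add: s_def)
qed

lemma inner_positive_op:
  assumes "positive_op A" shows "inner x (A x) = eigval A x" "inner (A x) y = inner x (A y)"
  using positive_op_symmetric[OF assms, of x y] by (simp_all add: eigval_def Re_cinner[symmetric])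

lemma eigval_add_scaleR:
  assumes A: "positive_op A"
  shows "eigval A (x + t *\<^sub>R y) = eigval A x + 2 * t * inner y (A x) + t\<^sup>2 * eigval A y"
proof -
  interpret A: bounded_linear A using A by (rule positive_op_bounded_linear)
  show ?thesis
    using inner_positive_op(2)[OF A, of x y]
    by (simp add: inner_positive_op(1)[OF A, symmetric] A.add A.scaleR inner_add_left inner_add_right
        inner_commute power2_eq_square algebra_simps)
qed

lemma eigval_scaleC:
  assumes A: "positive_op A" shows "eigval A (c *\<^sub>C x) = (cmod c)\<^sup>2 * eigval A x"
proof -
  have "cinner (c *\<^sub>C x) (A (c *\<^sub>C x)) = complex_of_real ((cmod c)\<^sup>2 * eigval A x)"
    unfolding positive_op_scaleC[OF A] cinner_scaleC_left cinner_scaleC_right cinner_eigval[OF A]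
      of_real_mult complex_norm_square
    by (simp add: mult_ac)
  then show ?thesis unfolding eigval_def[of A "c *\<^sub>C x"] by simp
qed

lemma inner_positive_op_le:
  assumes A: "positive_op A"
  shows "(inner x (A y))\<^sup>2 \<le> eigval A x * eigval A y"
proof -
  have pos: "0 \<le> eigval A y + 2 * t * inner x (A y) + t\<^sup>2 * eigval A x" for t
    using eigval_nonneg[OF A, of "y + t *\<^sub>R x"] by (simp add: eigval_add_scaleR[OF A])
  show ?thesis
  proof (cases "eigval A x = 0")
    case True
    have "inner x (A y) = 0"
    proof (rule ccontr)
      assume "inner x (A y) \<noteq> 0"
      \<comment> \<open>For this t the nonnegative quadratic, which is affine here, takes the value
        -1.\<close>
      then show False
        using pos[of "- (eigval A y + 1) / (2 * inner x (A y))"] True by (simp add: field_simps)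
    qed
    then show ?thesis using True by simp
  next
    case False
    then have "eigval A x > 0" using eigval_nonneg[OF A, of x] by linarith
    then show ?thesis
      using pos[of "- inner x (A y) / eigval A x"] by (simp add: field_simps power2_eq_square)
  qed
qed

lemma cinner_positive_op_le:
  assumes A: "positive_op A"
  shows "cmod (cinner x (A y)) \<le> sqrt (eigval A x) * sqrt (eigval A y)"
proof -
  obtain u where u: "cmod u = 1" "u * cinner x (A y) = complex_of_real (cmod (cinner x (A y)))"
    using exists_phase[of "cinner x (A y)"] by blast
  have "cmod (cinner x (A y)) = inner x (A (u *\<^sub>C y))"
    unfolding Re_cinner[symmetric] positive_op_scaleC[OF A] cinner_scaleC_right u(2) by simp
  then have "(cmod (cinner x (A y)))\<^sup>2 \<le> eigval A x * eigval A y"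
    using inner_positive_op_le[OF A, of x "u *\<^sub>C y"] u(1) by (simp add: eigval_scaleC[OF A])
  then show ?thesis
    unfolding real_sqrt_mult[symmetric] by (rule real_le_rsqrt)
qed

text \<open>The square root of the quadratic form is a seminorm; weak continuity of the form is
  later proved through this seminorm.\<close>

lemma sqrt_eigval_triangle:
  assumes A: "positive_op A"
  shows "sqrt (eigval A (x + y)) \<le> sqrt (eigval A x) + sqrt (eigval A y)"
proof (rule real_le_lsqrt)
  have "inner y (A x) \<le> sqrt (eigval A y) * sqrt (eigval A x)"
    using cinner_positive_op_le[OF A, of y x] complex_Re_le_cmod[of "cinner y (A x)"]
    by (simp add: Re_cinner)
  then show "eigval A (x + y) \<le> (sqrt (eigval A x) + sqrt (eigval A y))\<^sup>2"
    using eigval_add_scaleR[OF A, of x 1 y] eigval_nonneg[OF A]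
    by (simp add: power2_sum mult.commute)
qed (use eigval_nonneg[OF A] in auto)

lemma sqrt_eigval_sum:
  assumes A: "positive_op A"
  shows "sqrt (eigval A (\<Sum>e\<in>F. c e *\<^sub>C e)) \<le> (\<Sum>e\<in>F. cmod (c e) * sqrt (eigval A e))"
proof (induction F rule: infinite_finite_induct)
  case (insert e F)
  have "sqrt (eigval A (c e *\<^sub>C e + (\<Sum>e\<in>F. c e *\<^sub>C e)))
      \<le> sqrt (eigval A (c e *\<^sub>C e)) + sqrt (eigval A (\<Sum>e\<in>F. c e *\<^sub>C e))"
    by (rule sqrt_eigval_triangle[OF A])
  then show ?case using insert by (simp add: eigval_scaleC[OF A] real_sqrt_mult)
qed (auto simp: eigval_def cinner.zero_left linear_0[OF bounded_linear.linear[OF positive_op_bounded_linear[OF A]]])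

text \<open>Needed to evaluate the \<open>THE\<close> in \<open>abs_op\<close> at a positive
  operator. With D = A - P and S = A + P, the sum S D + D S vanishes, so S x and D x are orthogonal.
  The supremum m of the form of |D| type, \<open>q x\<close>, bounds the norm of D. If m were
  positive, a near-maximizer x would satisfy D x = \<mu> x approximately with |\<mu>| = m, whereas
  the inner product of S x with x is at least \<open>q x\<close>, close to m; this contradicts
  orthogonality.\<close>

lemma positive_sqrt_unique:
  fixes A P :: "'a::real_inner \<Rightarrow> 'a"
  assumes A: "bounded_linear A" "\<And>x y. inner (A x) y = inner x (A y)" "\<And>x. inner x (A x) \<ge> 0"
    and P: "bounded_linear P" "\<And>x y. inner (P x) y = inner x (P y)" "\<And>x. inner x (P x) \<ge> 0"
    and eq: "\<And>x. A (A x) = P (P x)"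
  shows "A = P"
proof -
  define D S where "D x = A x - P x" and "S x = A x + P x" for x
  interpret A: bounded_linear A by (rule A)
  interpret P: bounded_linear P by (rule P)
  interpret D: bounded_linear D unfolding D_def by (intro bounded_linear_sub A P)
  interpret S: bounded_linear S unfolding S_def by (intro bounded_linear_add A P)
  have Dsym: "inner (D x) y = inner x (D y)" and Ssym: "inner (S x) y = inner x (S y)" for x y
    by (simp_all add: D_def S_def A(2) P(2) inner_diff_left inner_diff_right inner_add_left inner_add_right)
  have anti: "inner (S x) (D x) = 0" for x
  proof -
    have "S (D x) + D (S x) = 0"
      by (simp add: D_def S_def A.add A.diff P.add P.diff eq)
    then have "inner x (S (D x)) + inner x (D (S x)) = 0"
      by (metis inner_add_right inner_zero_right)
    then show ?thesis
      using Ssym[of x "D x"] Dsym[of x "S x"] by (simp add: inner_commute)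
  qed
  obtain K where K: "K > 0" "\<And>x. norm (S x) \<le> norm x * K" using S.pos_bounded by blast
  obtain B where B: "B > 0" "\<And>x. norm (D x) \<le> norm x * B" using D.pos_bounded by blast
  define q where "q x = \<bar>inner x (D x)\<bar>" for x
  define m where "m = (SUP x\<in>cball 0 1. q x)"
  have bdd: "bdd_above (q ` cball 0 1)"
  proof (rule bdd_aboveI2)
    fix x :: 'a assume x: "x \<in> cball 0 1"
    have "q x \<le> norm x * norm (D x)"
      unfolding q_def by (rule Cauchy_Schwarz_ineq2)
    also have "\<dots> \<le> 1 * (1 * B)"
      using x B(2)[of x] B(1) by (intro mult_mono order_trans[OF B(2)]) auto
    finally show "q x \<le> B" by simp
  qed
  have qm: "q x \<le> m * (norm x)\<^sup>2" for x
  proof (cases "x = 0")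
    case False
    have "q (x /\<^sub>R norm x) \<le> m"
      unfolding m_def by (rule cSUP_upper[OF _ bdd]) (use False in auto)
    moreover have "q (x /\<^sub>R norm x) = q x / (norm x)\<^sup>2"
      by (simp add: q_def D.scaleR abs_mult power2_eq_square divide_inverse)
    ultimately have "q x / (norm x)\<^sup>2 \<le> m" by metis
    then show ?thesis using False by (simp add: divide_le_eq)
  qed (simp add: q_def)
  have m0: "m \<ge> 0"
    unfolding m_def by (rule cSUP_upper2[OF bdd, of 0]) (auto simp: q_def)
  have Dm: "norm (D x) \<le> m * norm x" for x
  proof (cases "D x = 0")
    case False
    \<comment> \<open>D x rescaled to the norm of x: polarization and the parallelogram law then
      turn the bound on the form into a bound on the operator.\<close>
    define y where "y = (norm x / norm (D x)) *\<^sub>R D x"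
    have ny: "norm y = norm x" using False by (simp add: y_def)
    have "4 * inner y (D x) = inner (x + y) (D (x + y)) - inner (x - y) (D (x - y))"
      using Dsym[of x y] by (simp add: D.add D.diff inner_add_left inner_add_right inner_diff_left
          inner_diff_right inner_commute)
    also have "\<dots> \<le> m * (norm (x + y))\<^sup>2 + m * (norm (x - y))\<^sup>2"
      using qm[of "x + y"] qm[of "x - y"] unfolding q_def by linarith
    also have "\<dots> = m * (4 * (norm x)\<^sup>2)"
    proof -
      have "(norm (x + y))\<^sup>2 + (norm (x - y))\<^sup>2 = 2 * (norm x)\<^sup>2 + 2 * (norm y)\<^sup>2"
        by (simp add: power2_norm_eq_inner inner_add_left inner_add_right inner_diff_left
            inner_diff_right inner_commute)
      then show ?thesis unfolding ring_distribs(1)[symmetric] ny by simp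
    qed
    finally have "inner y (D x) \<le> m * (norm x)\<^sup>2" by simp
    moreover have "inner y (D x) = norm x * norm (D x)"
      using False by (simp add: y_def power2_norm_eq_inner[symmetric] power2_eq_square)
    ultimately have "norm x * norm (D x) \<le> norm x * (m * norm x)"
      by (simp add: power2_eq_square mult_ac)
    moreover have "norm x > 0" using False D.zero by auto
    ultimately show ?thesis by simp
  qed (use m0 in simp)
  have "m = 0"
  proof (rule ccontr)
    assume "m \<noteq> 0" then have mp: "m > 0" using m0 by simp
    \<comment> \<open>The first bound keeps the form of S at x above m/2. The second makes the error
      term at most m^4 / 8, against a lower bound of m^4 / 4; the summand 1 keeps the quotient of
      K^2 by K^2 + 1 below 1.\<close>
    define \<epsilon> where "\<epsilon> = min (m/2) (m^3 / (16 * (K\<^sup>2 + 1)))"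
    have \<epsilon>: "\<epsilon> > 0" "\<epsilon> \<le> m/2" "\<epsilon> \<le> m^3 / (16 * (K\<^sup>2 + 1))"
      unfolding \<epsilon>_def by (simp add: mp add_nonneg_pos, rule min.cobounded1, rule min.cobounded2)
    have "\<exists>x\<in>cball 0 1. m - \<epsilon> < q x"
      using less_cSUP_iff[OF _ bdd, of "m - \<epsilon>"] \<epsilon>(1) by (auto simp: m_def[symmetric])
    then obtain x where x: "norm x \<le> 1" "m - \<epsilon> < q x" by auto
    \<comment> \<open>The sign is that of the form at x, so that x is an approximate eigenvector for
      \<mu>.\<close>
    define \<mu> where "\<mu> = (if inner x (D x) \<ge> 0 then m else - m)"
    have \<mu>: "\<mu> * inner x (D x) = m * q x" "\<mu>\<^sup>2 = m\<^sup>2" "\<bar>\<mu>\<bar> = m"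
      using mp by (auto simp: \<mu>_def q_def)
    have "(norm (D x - \<mu> *\<^sub>R x))\<^sup>2 = (norm (D x))\<^sup>2 - 2 * (\<mu> * inner x (D x)) + \<mu>\<^sup>2 * (norm x)\<^sup>2"
      unfolding power2_norm_eq_inner
      by (simp add: inner_diff_left inner_diff_right inner_commute power2_eq_square[of \<mu>] algebra_simps)
    also have "\<dots> \<le> m\<^sup>2 * 1 - 2 * (m * (m - \<epsilon>)) + m\<^sup>2 * 1"
      unfolding \<mu>(1,2)
    proof (intro add_mono diff_mono mult_left_mono)
      have "norm (D x) \<le> m" using Dm[of x] x(1) mp by (meson mult_left_le order_trans less_imp_le)
      then show "(norm (D x))\<^sup>2 \<le> m\<^sup>2 * 1" by (simp add: power_mono)
    qed (use x mp in \<open>auto simp: power_le_one\<close>)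
    also have "\<dots> = 2 * m * \<epsilon>" by (simp add: power2_eq_square algebra_simps)
    finally have err: "(norm (D x - \<mu> *\<^sub>R x))\<^sup>2 \<le> 2 * m * \<epsilon>" .
    have qS: "q x \<le> inner x (S x)"
      using A(3)[of x] P(3)[of x] by (auto simp: q_def D_def S_def inner_diff_right inner_add_right)
    have "0 = inner (S x) (D x - \<mu> *\<^sub>R x) + \<mu> * inner x (S x)"
      using anti[of x] by (simp add: inner_diff_right inner_commute)
    then have "\<bar>\<mu> * inner x (S x)\<bar> = \<bar>inner (S x) (D x - \<mu> *\<^sub>R x)\<bar>" by linarith
    moreover have "0 \<le> inner x (S x)" using A(3)[of x] P(3)[of x] by (simp add: S_def inner_add_right)
    ultimately have "m * inner x (S x) = \<bar>inner (S x) (D x - \<mu> *\<^sub>R x)\<bar>"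
      by (simp add: abs_mult \<mu>(3))
    also have "\<dots> \<le> norm (S x) * norm (D x - \<mu> *\<^sub>R x)" by (rule Cauchy_Schwarz_ineq2)
    also have "\<dots> \<le> K * norm (D x - \<mu> *\<^sub>R x)"
    proof (rule mult_right_mono)
      have "norm x * K \<le> 1 * K" using x(1) K(1) by (intro mult_right_mono) auto
      then show "norm (S x) \<le> K" using K(2)[of x] by simp
    qed simp
    finally have le: "m * inner x (S x) \<le> K * norm (D x - \<mu> *\<^sub>R x)" .
    have lower: "m * (m / 2) \<le> m * inner x (S x)"
      using qS x(2) \<epsilon>(2) mp by (intro mult_left_mono) auto
    have "(m * (m / 2))\<^sup>2 \<le> (K * norm (D x - \<mu> *\<^sub>R x))\<^sup>2"
      by (rule power_mono[OF order_trans[OF lower le]]) (use mp in simp)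
    also have "\<dots> \<le> K\<^sup>2 * (2 * m * (m^3 / (16 * (K\<^sup>2 + 1))))"
    proof -
      have "2 * m * \<epsilon> \<le> 2 * m * (m^3 / (16 * (K\<^sup>2 + 1)))"
        using \<epsilon>(3) mp by (intro mult_left_mono) auto
      from order_trans[OF err this] show ?thesis
        unfolding power_mult_distrib by (rule mult_left_mono) simp
    qed
    also have "\<dots> = m^4 / 8 * (K\<^sup>2 / (K\<^sup>2 + 1))"
    proof -
      have "k * (2 * m * (m^3 / (16 * n))) = m^4 / 8 * (k / n)" for k n :: real
        by (cases "n = 0") (simp_all add: field_simps power3_eq_cube power4_eq_xxxx)
      then show ?thesis .
    qed
    also have "\<dots> \<le> m^4 / 8 * 1"
    proof (rule mult_left_mono)
      have "0 < K\<^sup>2 + 1" by (simp add: add_nonneg_pos)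
      then show "K\<^sup>2 / (K\<^sup>2 + 1) \<le> 1" by simp
    qed simp
    finally have "m^4 / 4 \<le> m^4 / 8"
      by (simp add: power4_eq_xxxx power2_eq_square)
    then show False using mp by simp
  qed
  then have "A x = P x" for x using Dm[of x] by (simp add: D_def)
  then show ?thesis by blast
qed

section \<open>Adjoint and absolute value of a positive operator\<close>

lemma cadjoint_positive_op:
  assumes "positive_op A" shows "cadjoint A = A"
  unfolding cadjoint_def
proof (rule the_equality)
  show "\<forall>x y. cinner (A x) y = cinner x (A y)" using positive_op_symmetric[OF assms] by blast
  show "B = A" if "\<forall>x y. cinner (A x) y = cinner x (B y)" for B
    using that positive_op_symmetric[OF assms] by (intro ext cinner_ext) metis
qed

lemma abs_op_positive_op:
  assumes A: "positive_op A" shows "abs_op A = A"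
  unfolding abs_op_def cadjoint_positive_op[OF A]
proof (rule the_equality)
  fix P assume P: "positive_op P \<and> P \<circ> P = A \<circ> A"
  show "P = A"
  proof (rule positive_sqrt_unique)
    show "P (P x) = A (A x)" for x using P by (metis comp_apply)
  qed (use P A in \<open>auto simp: positive_op_bounded_linear inner_positive_op eigval_nonneg\<close>)
qed (use A in simp)

lemma positive_trace_class_iff:
  "A \<in> positive_trace_class \<longleftrightarrow> positive_op A \<and> eigval A summable_on some_onb"
proof -
  have "(\<lambda>e. cinner e (A e)) summable_on some_onb \<longleftrightarrow> eigval A summable_on some_onb"
    if "positive_op A"
    unfolding cinner_eigval[OF that] using summable_on_of_real[of "eigval A" some_onb]
      summable_on_bounded_linear[OF bounded_linear_Re, of "\<lambda>x. complex_of_real (eigval A x)" some_onb]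
    by auto
  then show ?thesis
    by (auto simp: positive_trace_class_def trace_class_def abs_op_positive_op positive_op_def)
qed

lemma has_sum_finite_sum:
  fixes f :: "'i \<Rightarrow> 'a \<Rightarrow> 'b::topological_comm_monoid_add"
  assumes "\<And>i. i \<in> I \<Longrightarrow> (f i has_sum s i) A"
  shows "((\<lambda>x. \<Sum>i\<in>I. f i x) has_sum (\<Sum>i\<in>I. s i)) A"
  using assms by (induction I rule: infinite_finite_induct) (auto intro!: has_sum_add has_sum_0)

section \<open>Eigenbases of positive trace-class operators\<close>

text \<open>Summability of the diagonal makes the seminorm weakly continuous on bounded sets: up to
  \<epsilon> times the norm, only finitely many coordinates matter. The tail of the expansion is
  estimated by Cauchy-Schwarz against the tail of the diagonal.\<close>

lemma eigval_tail:
  assumes A: "positive_op A" and E: "is_onb E" and sm: "eigval A summable_on E" and "\<epsilon> > 0"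
  obtains F where "finite F" "F \<subseteq> E"
    "\<And>z. sqrt (eigval A z) \<le> (\<Sum>e\<in>F. cmod (cinner e z) * sqrt (eigval A e)) + \<epsilon> * norm z"
proof -
  have on: "orthonormal E" using E by (simp add: is_onb_iff)
  obtain L where L: "(eigval A has_sum L) E" using sm by (auto simp: summable_on_def)
  have "eventually (\<lambda>F. dist (sum (eigval A) F) L < \<epsilon>\<^sup>2) (finite_subsets_at_top E)"
    using L \<open>\<epsilon> > 0\<close> unfolding has_sum_def by (intro tendstoD) auto
  then obtain F where F: "finite F" "F \<subseteq> E" and near: "dist (sum (eigval A) F) L < \<epsilon>\<^sup>2"
    by (auto simp: eventually_finite_subsets_at_top)
  have tail: "sum (eigval A) (G - F) \<le> \<epsilon>\<^sup>2" if "finite G" "F \<subseteq> G" "G \<subseteq> E" for G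
  proof -
    have "sum (eigval A) G \<le> L"
      using that eigval_nonneg[OF A] by (intro finite_sum_le_has_sum[OF L]) auto
    then show ?thesis using that near by (simp add: sum_diff dist_real_def)
  qed
  obtain K where K: "K > 0" "\<And>x. norm (A x) \<le> norm x * K"
    using bounded_linear.pos_bounded[OF positive_op_bounded_linear[OF A]] by blast
  have lip: "sqrt (eigval A w) \<le> sqrt K * norm w" for w
  proof (rule real_le_lsqrt)
    have "eigval A w \<le> norm w * norm (A w)"
      unfolding inner_positive_op(1)[OF A, symmetric] by (rule norm_cauchy_schwarz)
    also have "\<dots> \<le> norm w * (norm w * K)" by (intro mult_left_mono K) auto
    finally show "eigval A w \<le> (sqrt K * norm w)\<^sup>2"
      using K(1) by (simp add: power_mult_distrib power2_eq_square[of "norm w"] mult_ac)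
  qed (use K(1) eigval_nonneg[OF A] in auto)
  have "sqrt (eigval A z) \<le> (\<Sum>e\<in>F. cmod (cinner e z) * sqrt (eigval A e)) + \<epsilon> * norm z" for z
  proof (rule field_le_epsilon)
    fix \<delta> :: real assume "\<delta> > 0"
    then have "\<delta> / sqrt K > 0" using K(1) by simp
    then obtain G0 where G0: "finite G0" "G0 \<subseteq> E"
      and d0: "norm (z - (\<Sum>f\<in>G0. cinner f z *\<^sub>C f)) < \<delta> / sqrt K"
      using onb_approx[OF E] by metis
    \<comment> \<open>\<open>F\<close> makes the tail of the diagonal small, \<open>G0\<close> makes
      the expansion of z accurate; enlarging the index set only improves the latter.\<close>
    define G where "G = F \<union> G0"
    have G: "finite G" "G \<subseteq> E" "F \<subseteq> G" using F G0 by (auto simp: G_def)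
    let ?p = "\<Sum>f\<in>G. cinner f z *\<^sub>C f"
    have d: "norm (z - ?p) < \<delta> / sqrt K"
      using norm_diff_projection_mono[OF on G(1,2), of G0 z] d0 by (simp add: G_def)
    have "sqrt (eigval A z) \<le> sqrt (eigval A ?p) + sqrt (eigval A (z - ?p))"
      using sqrt_eigval_triangle[OF A, of ?p "z - ?p"] by simp
    also have "sqrt (eigval A (z - ?p)) \<le> \<delta>"
      using lip[of "z - ?p"] d K(1) by (simp add: less_divide_eq mult.commute)
    also have "sqrt (eigval A ?p) \<le> (\<Sum>e\<in>G. cmod (cinner e z) * sqrt (eigval A e))"
      by (rule sqrt_eigval_sum[OF A])
    also have "\<dots> = (\<Sum>e\<in>F. cmod (cinner e z) * sqrt (eigval A e))
        + (\<Sum>e\<in>G - F. cmod (cinner e z) * sqrt (eigval A e))"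
      using G by (simp add: sum.subset_diff[of F G])
    also have "(\<Sum>e\<in>G - F. cmod (cinner e z) * sqrt (eigval A e)) \<le> norm z * \<epsilon>"
    proof -
      have "(\<Sum>e\<in>G - F. cmod (cinner e z) * sqrt (eigval A e))
          \<le> L2_set (\<lambda>e. cmod (cinner e z)) (G - F) * L2_set (\<lambda>e. sqrt (eigval A e)) (G - F)"
        using L2_set_mult_ineq[of "\<lambda>e. cmod (cinner e z)" "\<lambda>e. sqrt (eigval A e)" "G - F"]
          eigval_nonneg[OF A] by simp
      also have "\<dots> \<le> norm z * \<epsilon>"
      proof (rule mult_mono)
        show "L2_set (\<lambda>e. cmod (cinner e z)) (G - F) \<le> norm z"
          unfolding L2_set_def using bessel[OF on, of "G - F" z] G by (intro real_le_lsqrt) (auto intro: sum_nonneg)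
        show "L2_set (\<lambda>e. sqrt (eigval A e)) (G - F) \<le> \<epsilon>"
          unfolding L2_set_def using tail[of G] G \<open>\<epsilon> > 0\<close> eigval_nonneg[OF A]
          by (intro real_le_lsqrt) (auto intro: sum_nonneg)
      qed (auto simp: L2_set_nonneg)
      finally show ?thesis .
    qed
    finally show "sqrt (eigval A z) \<le> (\<Sum>e\<in>F. cmod (cinner e z) * sqrt (eigval A e)) + \<epsilon> * norm z + \<delta>"
      by (simp add: mult.commute)
  qed
  then show thesis using that F by blast
qed

locale separable_hilbert =
  fixes D :: "'a::complex_hilbert set"
  assumes countable_dense: "countable D" "closure D = UNIV"
begin

lemma countable_onb: "is_onb (E :: 'a set) \<Longrightarrow> countable E"
  using countable_orthonormal[OF countable_dense] by (simp add: is_onb_iff)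

text \<open>A diagonal subsequence makes all coefficients in a countable basis converge, and
  \<open>weak_limit\<close> does the rest.\<close>

lemma weak_compact:
  fixes y :: "nat \<Rightarrow> 'a"
  assumes M: "\<And>n. norm (y n) \<le> M"
  obtains r z where "strict_mono (r :: nat \<Rightarrow> nat)" "norm z \<le> M"
    "\<And>x. (\<lambda>n. cinner x (y (r n))) \<longlonglongrightarrow> cinner x z"
proof -
  obtain E :: "'a set" where E: "is_onb E" using exists_onb by blast
  have "cmod (cinner e (y n)) \<le> M" if "e \<in> E" for e n
    using cmod_cinner_le[of e "y n"] that E M[of n] by (simp add: is_onb_def)
  then obtain r where r: "strict_mono (r :: nat \<Rightarrow> nat)"
    and c: "\<And>e. e \<in> E \<Longrightarrow> \<exists>l. (\<lambda>n. cinner e (y (r n))) \<longlonglongrightarrow> l"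
    using function_convergent_subsequence[OF countable_onb[OF E], of "\<lambda>n e. cinner e (y n)" M]
    by metis
  obtain z where "norm z \<le> M" "\<And>x. (\<lambda>n. cinner x (y (r n))) \<longlonglongrightarrow> cinner x z"
    using weak_limit[OF E, of "\<lambda>n. y (r n)" M] M c by (metis convergent_def)
  then show thesis using that r by blast
qed

text \<open>
  On the orthogonal complement of a maximal orthonormal family of eigenvectors, the quadratic form
  attains its maximum over the unit ball because it is weakly continuous there; a maximizer is a
  further eigenvector.
\<close>

lemma exists_eigenbasis:
  fixes A :: "'a \<Rightarrow> 'a"
  assumes A: "positive_op A" and E: "is_onb E" and sm: "eigval A summable_on E"
  shows "\<exists>B. is_eigenbasis A B"
proof -
  interpret A: bounded_linear A using A by (rule positive_op_bounded_linear)
  obtain B where B: "orthonormal B" and eig: "\<And>b. b \<in> B \<Longrightarrow> \<exists>c. A b = c *\<^sub>C b"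
    and max: "\<And>x. norm x = 1 \<Longrightarrow> \<exists>c. A x = c *\<^sub>C x \<Longrightarrow> \<exists>b\<in>B. cinner b x \<noteq> 0"
    using maximal_orthonormal[of "\<lambda>x. \<exists>c. A x = c *\<^sub>C x"] by auto
  define M where "M = {x. \<forall>b\<in>B. cinner b x = 0}"
  have M0: "0 \<in> M" and Madd: "x \<in> M \<Longrightarrow> y \<in> M \<Longrightarrow> x + t *\<^sub>R y \<in> M" for x y t
    by (auto simp: M_def cinner_add_right cinner.scaleR_right cinner.zero_right)
  have Mscale: "x \<in> M \<Longrightarrow> t *\<^sub>R x \<in> M" for x t using Madd[of 0 x t] M0 by simp
  \<comment> \<open>The complement is invariant because \<open>A\<close> is symmetric, so the
    residual \<open>v\<close> of the maximizer stays in \<open>M\<close>.\<close>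
  have AM: "A x \<in> M" if "x \<in> M" for x
    unfolding M_def
  proof safe
    fix b assume b: "b \<in> B"
    then obtain c where "A b = c *\<^sub>C b" using eig by blast
    then show "cinner b (A x) = 0"
      using positive_op_symmetric[OF A, of b x] that b by (simp add: cinner_scaleC_left M_def)
  qed
  have no_eig: "x = 0" if "x \<in> M" "A x = c *\<^sub>C x" for x c
  proof (rule ccontr)
    assume "x \<noteq> 0"
    then have "norm (x /\<^sub>R norm x) = 1" by simp
    moreover have "A (x /\<^sub>R norm x) = c *\<^sub>C (x /\<^sub>R norm x)"
      using that by (simp add: A.scaleR scaleC.scaleR_right)
    ultimately show False
      using max[of "x /\<^sub>R norm x"] Mscale[OF that(1), of "inverse (norm x)"] by (auto simp: M_def)
  qed
  obtain K where K: "K > 0" "\<And>x. norm (A x) \<le> norm x * K" using A.pos_bounded by blast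
  define S where "S = M \<inter> cball 0 1"
  have bdd: "bdd_above (eigval A ` S)"
  proof (rule bdd_aboveI2)
    fix x assume "x \<in> S"
    then have x: "norm x \<le> 1" by (simp add: S_def)
    have "eigval A x \<le> norm x * norm (A x)"
      unfolding inner_positive_op(1)[OF A, symmetric] by (rule norm_cauchy_schwarz)
    also have "\<dots> \<le> 1 * (1 * K)"
    proof (intro mult_mono x order_trans[OF K(2)])
    qed (use K(1) in auto)
    finally show "eigval A x \<le> K" by simp
  qed
  have S0: "0 \<in> S" using M0 by (simp add: S_def)
  define \<mu> where "\<mu> = (SUP x\<in>S. eigval A x)"
  have le_mu: "eigval A x \<le> \<mu>" if "x \<in> S" for x
    unfolding \<mu>_def using that bdd by (rule cSUP_upper)
  have mu0: "\<mu> \<ge> 0" using le_mu[OF S0] eigval_nonneg[OF A, of 0] by linarith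
  have le_mu_norm: "eigval A x \<le> \<mu> * (norm x)\<^sup>2" if "x \<in> M" for x
  proof (cases "x = 0")
    case False
    have "eigval A (inverse (norm x) *\<^sub>R x) \<le> \<mu>"
      using Mscale[OF that, of "inverse (norm x)"] False by (intro le_mu) (simp add: S_def)
    then have "eigval A x / (norm x)\<^sup>2 \<le> \<mu>"
      by (simp add: scaleC_of_real[symmetric] eigval_scaleC[OF A] norm_inverse power_inverse
          divide_inverse mult.commute del: of_real_inverse)
    then show ?thesis using False by (simp add: divide_le_eq)
  qed (use mu0 in \<open>simp add: eigval_def cinner.zero_left\<close>)
  have "\<exists>x\<in>S. \<mu> - inverse (real (Suc n)) < eigval A x" for n
    using less_cSUP_iff[OF _ bdd, of "\<mu> - inverse (real (Suc n))"] S0 by (auto simp: \<mu>_def[symmetric])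
  then obtain x where x: "\<And>n. x n \<in> S" "\<And>n. \<mu> - inverse (real (Suc n)) < eigval A (x n)" by metis
  have "norm (x n) \<le> 1" for n using x(1)[of n] by (simp add: S_def)
  from weak_compact[of x, OF this] obtain r z where r: "strict_mono (r :: nat \<Rightarrow> nat)"
    and z: "norm z \<le> 1" and wk: "\<And>w. (\<lambda>n. cinner w (x (r n))) \<longlonglongrightarrow> cinner w z" by metis
  have zM: "z \<in> M"
    unfolding M_def
  proof safe
    fix b assume "b \<in> B"
    then have "cinner b (x (r n)) = 0" for n using x(1)[of "r n"] by (simp add: S_def M_def)
    then show "cinner b z = 0" using LIMSEQ_unique[OF wk[of b]] by simp
  qed
  have "sqrt \<mu> \<le> sqrt (eigval A z)"
  proof (rule field_le_epsilon)
    \<comment> \<open>The factor e/2 fits the distance of at most 2 between two vectors of the unit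
      ball.\<close>
    fix e :: real assume "e > 0"
    obtain F where F: "finite F" "F \<subseteq> E"
      and tail: "\<And>w. sqrt (eigval A w) \<le> (\<Sum>e\<in>F. cmod (cinner e w) * sqrt (eigval A e)) + e/2 * norm w"
      using eigval_tail[OF A E sm, of "e/2"] \<open>e > 0\<close> by auto
    have mu_lim: "(\<lambda>n. sqrt (\<mu> - inverse (real (Suc (r n))))) \<longlonglongrightarrow> sqrt (\<mu> - 0)"
      by (intro tendsto_real_sqrt tendsto_diff tendsto_const
          LIMSEQ_subseq_LIMSEQ[OF LIMSEQ_inverse_real_of_nat r, unfolded o_def])
    have "(\<lambda>n. \<Sum>e\<in>F. cmod (cinner e (x (r n) - z)) * sqrt (eigval A e))
        \<longlonglongrightarrow> (\<Sum>e\<in>F. cmod (cinner e z - cinner e z) * sqrt (eigval A e))"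
      unfolding cinner.diff_right by (intro tendsto_intros wk)
    then have lim: "(\<lambda>n. sqrt (eigval A z) + ((\<Sum>e\<in>F. cmod (cinner e (x (r n) - z)) * sqrt (eigval A e)) + e))
        \<longlonglongrightarrow> sqrt (eigval A z) + (0 + e)"
      by (intro tendsto_intros) simp
    have "sqrt (\<mu> - inverse (real (Suc (r n))))
        \<le> sqrt (eigval A z) + ((\<Sum>e\<in>F. cmod (cinner e (x (r n) - z)) * sqrt (eigval A e)) + e)" for n
    proof -
      have "norm (x (r n) - z) \<le> norm (x (r n)) + norm z" by (rule norm_triangle_ineq4)
      then have "norm (x (r n) - z) \<le> 2" using x(1)[of "r n"] z by (simp add: S_def)
      then have "e/2 * norm (x (r n) - z) \<le> e" using \<open>e > 0\<close> by simp
      then have "sqrt (eigval A (x (r n) - z))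
          \<le> (\<Sum>e\<in>F. cmod (cinner e (x (r n) - z)) * sqrt (eigval A e)) + e"
        using tail[of "x (r n) - z"] by linarith
      moreover have "sqrt (eigval A (x (r n))) \<le> sqrt (eigval A z) + sqrt (eigval A (x (r n) - z))"
        using sqrt_eigval_triangle[OF A, of z "x (r n) - z"] by simp
      moreover have "sqrt (\<mu> - inverse (real (Suc (r n)))) \<le> sqrt (eigval A (x (r n)))"
        using x(2)[of "r n"] by simp
      ultimately show ?thesis by linarith
    qed
    then show "sqrt \<mu> \<le> sqrt (eigval A z) + e"
      using LIMSEQ_le[OF mu_lim lim] by auto
  qed
  then have "\<mu> \<le> eigval A z" by simp
  then have mu: "eigval A z = \<mu>" using le_mu[of z] z zM by (simp add: S_def)
  have "M = {0}"
  proof (cases "\<mu> = 0")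
    case True
    \<comment> \<open>The form vanishes on \<open>M\<close>, hence so does \<open>A\<close> by
      Cauchy-Schwarz, and nonzero vectors of \<open>M\<close> would be eigenvectors for the value
      0.\<close>
    have "w = 0" if "w \<in> M" for w
    proof -
      have "eigval A w = 0" using le_mu_norm[OF that] True eigval_nonneg[OF A, of w] by simp
      then have "cinner (A w) (A w) = 0"
        using cinner_positive_op_le[OF A, of "A w" w] by simp
      then have "A w = 0 *\<^sub>C w" by (simp add: cinner_eq_zero_iff scaleC.zero_left)
      then show ?thesis using no_eig that by blast
    qed
    then show ?thesis using M0 by auto
  next
    case False
    then have mup: "\<mu> > 0" using mu0 by simp
    \<comment> \<open>Half the gradient at z of the form minus \<mu> times the squared norm, a
      function that is at most 0 on \<open>M\<close> and vanishes at z. Moving from z by t v gains 2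
      t (norm v)^2 to first order and loses at most \<mu> t^2 (norm v)^2; with t = 1 / \<mu> the
      gain is twice the loss unless v = 0.\<close>
    define v where "v = A z + (- \<mu>) *\<^sub>R z"
    have vM: "v \<in> M" unfolding v_def using Madd AM zM by blast
    have nz: "norm z = 1"
    proof -
      have "\<mu> * 1 \<le> \<mu> * (norm z)\<^sup>2" using le_mu_norm[OF zM] mu by simp
      then have "1\<^sup>2 \<le> (norm z)\<^sup>2" using mup by simp
      then have "1 \<le> norm z" by (rule power2_le_imp_le) simp
      then show ?thesis using z by simp
    qed
    have "2 / \<mu> * (norm v)\<^sup>2 \<le> 1 / \<mu> * (norm v)\<^sup>2"
    proof -
      define t where "t = 1 / \<mu>"
      have t: "\<mu> * t = 1" using mup by (simp add: t_def)
      have "eigval A (z + t *\<^sub>R v) \<le> \<mu> * (norm (z + t *\<^sub>R v))\<^sup>2"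
        using le_mu_norm Madd[OF zM vM] by blast
      moreover have "(norm (z + t *\<^sub>R v))\<^sup>2 = (norm z)\<^sup>2 + 2 * t * inner v z + t\<^sup>2 * (norm v)\<^sup>2"
        unfolding power2_norm_eq_inner
        by (simp add: inner_add_left inner_add_right inner_commute power2_eq_square[of t] algebra_simps)
      ultimately have "\<mu> + 2 * t * inner v (A z) + t\<^sup>2 * eigval A v
          \<le> \<mu> * (1 + 2 * t * inner v z + t\<^sup>2 * (norm v)\<^sup>2)"
        by (simp add: eigval_add_scaleR[OF A] mu nz)
      also have "\<dots> = \<mu> + 2 * t * (\<mu> * inner v z) + t * (\<mu> * t) * (norm v)\<^sup>2"
        by (simp add: power2_eq_square[of t] algebra_simps)
      finally have "2 * t * (inner v (A z) - \<mu> * inner v z) + t\<^sup>2 * eigval A v \<le> t * (norm v)\<^sup>2"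
        unfolding t by (simp add: algebra_simps)
      moreover have v: "inner v v = inner v (A z) - \<mu> * inner v z"
        by (subst (2) v_def) (simp add: inner_diff_right)
      moreover have "0 \<le> t\<^sup>2 * eigval A v" using eigval_nonneg[OF A] by simp
      ultimately have "2 * t * (norm v)\<^sup>2 \<le> t * (norm v)\<^sup>2"
        unfolding power2_norm_eq_inner v[symmetric] by linarith
      then show ?thesis by (simp add: t_def)
    qed
    then have "(norm v)\<^sup>2 \<le> 0" using mup by (simp add: divide_le_cancel)
    then have "v = 0" by simp
    then have "A z = complex_of_real \<mu> *\<^sub>C z" by (simp add: v_def scaleC_of_real)
    then have "z = 0" using no_eig[OF zM] by blast
    then show ?thesis using nz by simp
  qed
  moreover have "x \<in> M" if "\<forall>b\<in>B. cinner b x = 0" for x using that by (simp add: M_def)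
  ultimately have "is_onb B" unfolding is_onb_iff using B by blast
  then show ?thesis using eig unfolding is_eigenbasis_def by blast
qed

lemma is_eigenbasis_some_eigenbasis:
  "A \<in> positive_trace_class \<Longrightarrow> is_eigenbasis A (some_eigenbasis (A :: 'a \<Rightarrow> 'a))"
  unfolding some_eigenbasis_def positive_trace_class_iff
  by (rule someI_ex) (use exists_eigenbasis[OF _ is_onb_some_onb] in blast)

end

lemma eigenbasis_eigval:
  assumes "is_eigenbasis A B" "positive_op A" "a \<in> B"
  shows "A a = complex_of_real (eigval A a) *\<^sub>C a"
proof -
  obtain c where c: "A a = c *\<^sub>C a" using assms by (auto simp: is_eigenbasis_def)
  have "cinner a a = 1"
    using assms orthonormal_cinner[of B a a] by (simp add: is_eigenbasis_def is_onb_iff)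
  then have "c = complex_of_real (eigval A a)"
    using cinner_eigval[OF assms(2), of a] by (simp add: c cinner_scaleC_right)
  then show ?thesis using c by simp
qed

lemma cinner_eigenvector:
  assumes "is_eigenbasis A B" "positive_op A" "a \<in> B"
  shows "cinner a (A x) = complex_of_real (eigval A a) * cinner a x"
  using positive_op_symmetric[OF assms(2), of a x] eigenbasis_eigval[OF assms]
  by (simp add: cinner_scaleC_left)

text \<open>The spectral expansion of the quadratic form; it stands in for a functional calculus
  below.\<close>

lemma eigval_has_sum:
  assumes B: "is_eigenbasis A B" and A: "positive_op A"
  shows "((\<lambda>a. eigval A a * (cmod (cinner a x))\<^sup>2) has_sum eigval A x) B"
proof -
  have "cinner x a * cinner a (A x) = complex_of_real (eigval A a * (cmod (cinner a x))\<^sup>2)"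
    if "a \<in> B" for a
    unfolding cinner_eigenvector[OF B A that] of_real_mult complex_norm_square
    using cinner_commute[of x a] by simp
  then have "((\<lambda>a. complex_of_real (eigval A a * (cmod (cinner a x))\<^sup>2)) has_sum
      complex_of_real (eigval A x)) B"
    using parseval_cinner[of B x "A x"] B unfolding cinner_eigval[OF A]
    by (simp add: is_eigenbasis_def cong: has_sum_cong)
  then show ?thesis by (simp only: has_sum_of_real_iff)
qed

section \<open>Bounded traces and weak convergence\<close>

text \<open>A bound on the trace that refers to no basis and tests finitely many values of the form
  at a time, so that it passes to weak limits.\<close>

definition trace_le :: "('a::complex_hilbert \<Rightarrow> 'a) \<Rightarrow> real \<Rightarrow> bool" where
  "trace_le A M \<longleftrightarrow> positive_op A \<and>
     (\<forall>F. finite F \<longrightarrow> orthonormal F \<longrightarrow> (\<Sum>e\<in>F. eigval A e) \<le> M)"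

lemma orthonormal_subset: "orthonormal E \<Longrightarrow> F \<subseteq> E \<Longrightarrow> orthonormal F"
  by (auto simp: orthonormal_def)

lemma trace_le_nonneg: "trace_le A M \<Longrightarrow> M \<ge> 0"
  unfolding trace_le_def by (metis finite.emptyI empty_iff orthonormal_def sum.empty)

lemma trace_le_summable:
  assumes "trace_le A M" "orthonormal E"
  shows "eigval A summable_on E" "infsum (eigval A) E \<le> M"
proof -
  have bd: "sum (eigval A) F \<le> M" if "finite F" "F \<subseteq> E" for F
    using assms that orthonormal_subset unfolding trace_le_def by blast
  show "eigval A summable_on E"
    using assms(1) bd by (intro nonneg_bdd_above_summable_on)
      (auto simp: trace_le_def eigval_nonneg intro!: bdd_aboveI[of _ M])
  then show "infsum (eigval A) E \<le> M" by (rule infsum_le_finite_sums) (rule bd)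
qed

lemma trace_le_positive_trace_class: "trace_le A M \<Longrightarrow> A \<in> positive_trace_class"
  using trace_le_summable[of A M some_onb] is_onb_some_onb
  by (auto simp: positive_trace_class_iff trace_le_def is_onb_iff)

text \<open>Expanding each form value in the eigenbasis and exchanging sums, every eigenvalue
  receives a total weight of at most 1 by Bessel. Hence an eigenbasis suffices as a test.\<close>

lemma trace_leI:
  assumes B: "is_eigenbasis A B" and A: "positive_op A"
    and M: "\<And>F. finite F \<Longrightarrow> F \<subseteq> B \<Longrightarrow> (\<Sum>a\<in>F. eigval A a) \<le> M"
  shows "trace_le A M"
  unfolding trace_le_def
proof (intro conjI allI impI A)
  fix F :: "'a set" assume F: "finite F" "orthonormal F"
  have "eigval A summable_on B"
    by (intro nonneg_bdd_above_summable_on) (auto simp: eigval_nonneg[OF A] intro!: bdd_aboveI[of _ M] M)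
  then have L: "(eigval A has_sum infsum (eigval A) B) B" by simp
  have "infsum (eigval A) B \<le> M"
    using \<open>eigval A summable_on B\<close> by (rule infsum_le_finite_sums) (rule M)
  have "((\<lambda>a. \<Sum>e\<in>F. eigval A a * (cmod (cinner a e))\<^sup>2) has_sum (\<Sum>e\<in>F. eigval A e)) B"
    by (intro has_sum_finite_sum eigval_has_sum[OF B A])
  then have "(\<Sum>e\<in>F. eigval A e) \<le> infsum (eigval A) B"
  proof (rule has_sum_mono[OF _ L])
    fix a assume "a \<in> B"
    have "(\<Sum>e\<in>F. (cmod (cinner a e))\<^sup>2) \<le> (norm a)\<^sup>2"
      using bessel[OF F(2,1) order_refl, of a] by (simp add: cmod_cinner_commute[of a])
    also have "\<dots> = 1" using B \<open>a \<in> B\<close> by (simp add: is_eigenbasis_def is_onb_def)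
    finally show "(\<Sum>e\<in>F. eigval A a * (cmod (cinner a e))\<^sup>2) \<le> eigval A a"
      unfolding sum_distrib_left[symmetric] using eigval_nonneg[OF A, of a]
      by (simp add: mult_left_le)
  qed
  then show "(\<Sum>e\<in>F. eigval A e) \<le> M" using \<open>infsum (eigval A) B \<le> M\<close> by simp
qed

text \<open>The passage from \<open>some_onb\<close> to the eigenbasis: by Parseval each eigenvalue
  is a sum over \<open>some_onb\<close>, and finitely many eigenvalues contribute at most the form
  at each basis vector.\<close>

lemma trace_le_exists:
  assumes B: "is_eigenbasis A B" and A: "A \<in> positive_trace_class"
  obtains M where "trace_le A M"
proof -
  have pos: "positive_op A" and sm: "eigval A summable_on some_onb"
    using A by (auto simp: positive_trace_class_iff)
  have "trace_le A (infsum (eigval A) some_onb)"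
  proof (rule trace_leI[OF B pos])
    fix F assume F: "finite F" "F \<subseteq> B"
    have "((\<lambda>e. (cmod (cinner e a))\<^sup>2) has_sum 1) some_onb" if "a \<in> F" for a
      using parseval[OF is_onb_some_onb, of a] that F B by (auto simp: is_eigenbasis_def is_onb_def)
    then have "((\<lambda>e. \<Sum>a\<in>F. eigval A a * (cmod (cinner e a))\<^sup>2) has_sum (\<Sum>a\<in>F. eigval A a * 1)) some_onb"
      by (intro has_sum_finite_sum has_sum_cmult_right)
    then have "(\<Sum>a\<in>F. eigval A a * 1) \<le> infsum (eigval A) some_onb"
    proof (rule has_sum_mono)
      show "(eigval A has_sum infsum (eigval A) some_onb) some_onb" using sm by simp
      fix e :: 'a
      show "(\<Sum>a\<in>F. eigval A a * (cmod (cinner e a))\<^sup>2) \<le> eigval A e"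
        unfolding cmod_cinner_commute[of e]
        using F eigval_nonneg[OF pos] by (intro finite_sum_le_has_sum[OF eigval_has_sum[OF B pos]]) auto
    qed
    then show "(\<Sum>a\<in>F. eigval A a) \<le> infsum (eigval A) some_onb" by simp
  qed
  then show thesis using that by blast
qed

lemma trace_le_norm:
  assumes B: "is_eigenbasis A B" and M: "trace_le A M"
  shows "norm (A x) \<le> M * norm x"
proof (rule power2_le_imp_le)
  have A: "positive_op A" and onb: "is_onb B" using M B by (auto simp: trace_le_def is_eigenbasis_def)
  show "(norm (A x))\<^sup>2 \<le> (M * norm x)\<^sup>2"
    unfolding power_mult_distrib
  proof (rule has_sum_mono[OF parseval[OF onb] has_sum_cmult_right[OF parseval[OF onb]]])
    fix a assume a: "a \<in> B"
    have "eigval A a \<le> M"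
    proof -
      have "orthonormal {a}" using a onb by (auto simp: is_onb_def orthonormal_def)
      then have "sum (eigval A) {a} \<le> M" using M unfolding trace_le_def by blast
      then show ?thesis by simp
    qed
    then have "(eigval A a)\<^sup>2 \<le> M\<^sup>2" using eigval_nonneg[OF A] by (rule power_mono)
    then show "(cmod (cinner a (A x)))\<^sup>2 \<le> M\<^sup>2 * (cmod (cinner a x))\<^sup>2"
      unfolding cinner_eigenvector[OF B A a] by (simp add: norm_mult power_mult_distrib mult_right_mono)
  qed
qed (use trace_le_nonneg[OF M] in simp)

text \<open>The vector is the adjoint of \<open>S\<close> applied to \<open>a\<close>, obtained one
  vector at a time from the Riesz representation.\<close>

lemma bounded_clinear_functional:
  assumes "bounded_clinear S"
  obtains w where "\<And>x. cinner a (S x) = cinner w x"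
proof -
  interpret S: bounded_linear S using assms by (simp add: bounded_clinear_def)
  have "bounded_linear (\<lambda>x. cinner a (S x))"
    by (rule bounded_linear_compose[OF cinner.bounded_linear_right S.bounded_linear_axioms])
  moreover have "cinner a (S (c *\<^sub>C x)) = c * cinner a (S x)" for c x
    using assms by (simp add: bounded_clinear_def cinner_scaleC_right)
  ultimately show thesis using that by (rule riesz_representation)
qed

text \<open>Bessel's inequality for the adjoint of \<open>S\<close> applied to \<open>a\<close>,
  whose norm is at most K times that of \<open>a\<close>.\<close>

lemma column_bound:
  assumes S: "bounded_clinear S" and K: "\<And>x. norm (S x) \<le> K * norm x" and "K \<ge> 0"
    and F: "finite F" "orthonormal F"
  shows "(\<Sum>e\<in>F. (cmod (cinner a (S e)))\<^sup>2) \<le> K\<^sup>2 * (norm a)\<^sup>2"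
proof -
  obtain w where w: "\<And>x. cinner a (S x) = cinner w x"
    using bounded_clinear_functional[OF S] by blast
  have "(norm w)\<^sup>2 = cmod (cinner a (S w))" unfolding w cinner_self norm_of_real by simp
  also have "\<dots> \<le> norm a * norm (S w)" by (rule cmod_cinner_le)
  also have "\<dots> \<le> norm a * (K * norm w)" by (intro mult_left_mono K) simp
  finally have "norm w * norm w \<le> (K * norm a) * norm w"
    by (simp add: power2_eq_square mult_ac)
  then have "norm w \<le> K * norm a"
    using \<open>K \<ge> 0\<close> by (cases "norm w = 0") auto
  then have "(norm w)\<^sup>2 \<le> K\<^sup>2 * (norm a)\<^sup>2"
    unfolding power_mult_distrib[symmetric] by (rule power_mono) simp
  then show ?thesis
    unfolding w using bessel[OF F(2,1) order_refl, of w] by (simp add: cmod_cinner_commute[of w])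
qed

text \<open>With T the adjoint of S, this is tr (T A S) \<le> K^2 tr A, tested on finite orthonormal
  families.\<close>

lemma trace_le_conjugate:
  assumes B: "is_eigenbasis A B" and M: "trace_le A M"
    and S: "bounded_clinear S" "\<And>x. norm (S x) \<le> K * norm x" "K \<ge> 0"
    and F: "finite F" "orthonormal F"
  shows "(\<Sum>e\<in>F. eigval A (S e)) \<le> K\<^sup>2 * M"
proof -
  have A: "positive_op A" and on: "orthonormal B"
    using M B by (auto simp: trace_le_def is_eigenbasis_def is_onb_iff)
  have L: "(eigval A has_sum infsum (eigval A) B) B"
    using trace_le_summable(1)[OF M on] by simp
  have "((\<lambda>a. \<Sum>e\<in>F. eigval A a * (cmod (cinner a (S e)))\<^sup>2) has_sum (\<Sum>e\<in>F. eigval A (S e))) B"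
    by (intro has_sum_finite_sum eigval_has_sum[OF B A])
  then have "(\<Sum>e\<in>F. eigval A (S e)) \<le> K\<^sup>2 * infsum (eigval A) B"
  proof (rule has_sum_mono[OF _ has_sum_cmult_right[OF L]])
    fix a assume "a \<in> B"
    then have "norm a = 1" using on by (simp add: orthonormal_def)
    then have "(\<Sum>e\<in>F. (cmod (cinner a (S e)))\<^sup>2) \<le> K\<^sup>2"
      using column_bound[OF S F, of a] by simp
    then show "(\<Sum>e\<in>F. eigval A a * (cmod (cinner a (S e)))\<^sup>2) \<le> K\<^sup>2 * eigval A a"
      unfolding sum_distrib_left[symmetric] mult.commute[of "K\<^sup>2"]
      using eigval_nonneg[OF A, of a] by (rule mult_left_mono)
  qed
  also have "\<dots> \<le> K\<^sup>2 * M" using trace_le_summable(2)[OF M on] by (simp add: mult_left_mono)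
  finally show ?thesis .
qed

text \<open>The duality bound |tr (A S)| \<le> K tr A: Cauchy-Schwarz for the form of
  \<open>A\<close>, then for the sum, with \<open>trace_le_conjugate\<close> bounding the second
  factor.\<close>

lemma trace_le_mult:
  assumes B: "is_eigenbasis A B" and M: "trace_le A M"
    and S: "bounded_clinear S" "\<And>x. norm (S x) \<le> K * norm x" "K \<ge> 0"
    and E: "orthonormal E"
  shows "(\<lambda>e. cmod (cinner e (A (S e)))) summable_on E"
    and "cmod (\<Sum>\<^sub>\<infinity>e\<in>E. cinner e (A (S e))) \<le> K * M"
proof -
  have A: "positive_op A" using M by (simp add: trace_le_def)
  have bd: "(\<Sum>e\<in>F. cmod (cinner e (A (S e)))) \<le> K * M" if F: "finite F" "F \<subseteq> E" for F
  proof -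
    have on: "orthonormal F" by (rule orthonormal_subset[OF E F(2)])
    have "(\<Sum>e\<in>F. cmod (cinner e (A (S e)))) \<le> (\<Sum>e\<in>F. sqrt (eigval A e) * sqrt (eigval A (S e)))"
      by (intro sum_mono cinner_positive_op_le[OF A])
    also have "\<dots> \<le> L2_set (\<lambda>e. sqrt (eigval A e)) F * L2_set (\<lambda>e. sqrt (eigval A (S e))) F"
      using L2_set_mult_ineq[of "\<lambda>e. sqrt (eigval A e)" "\<lambda>e. sqrt (eigval A (S e))" F]
        eigval_nonneg[OF A] by simp
    also have "\<dots> = sqrt (\<Sum>e\<in>F. eigval A e) * sqrt (\<Sum>e\<in>F. eigval A (S e))"
      using eigval_nonneg[OF A] by (simp add: L2_set_def)
    also have "\<dots> \<le> sqrt M * sqrt (K\<^sup>2 * M)"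
      using M F on trace_le_nonneg[OF M] trace_le_conjugate[OF B M S F(1) on] eigval_nonneg[OF A]
      by (intro mult_mono real_sqrt_le_mono) (auto simp: trace_le_def intro!: sum_nonneg)
    also have "\<dots> = K * M"
      using S(3) trace_le_nonneg[OF M] by (simp add: real_sqrt_mult)
    finally show ?thesis .
  qed
  show sm: "(\<lambda>e. cmod (cinner e (A (S e)))) summable_on E"
    by (rule nonneg_bdd_above_summable_on) (auto intro!: bdd_aboveI[of _ "K * M"] bd)
  have "cmod (\<Sum>\<^sub>\<infinity>e\<in>E. cinner e (A (S e))) \<le> (\<Sum>\<^sub>\<infinity>e\<in>E. cmod (cinner e (A (S e))))"
    by (rule norm_infsum_bound[OF sm])
  also have "\<dots> \<le> K * M" by (rule infsum_le_finite_sums[OF sm bd])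
  finally show "cmod (\<Sum>\<^sub>\<infinity>e\<in>E. cinner e (A (S e))) \<le> K * M" .
qed

text \<open>Basis vectors are collected that approximate every point of a finite \<epsilon>/2-net of
  the image of the unit ball within \<epsilon>/2. The complementary projection \<open>Q\<close> is a
  contraction, so points near the net lose only another \<epsilon>/2.\<close>

lemma compact_op_finite_rank_approx:
  assumes S: "S \<in> compact_ops" and E: "is_onb E" and "\<epsilon> > 0"
  obtains F where "finite F" "F \<subseteq> E"
    "\<And>x. norm (S x - (\<Sum>f\<in>F. cinner f (S x) *\<^sub>C f)) \<le> \<epsilon> * norm x"
proof -
  have on: "orthonormal E" using E by (simp add: is_onb_iff)
  interpret S: bounded_linear S using S by (simp add: compact_ops_def bounded_clinear_def)
  have "compact (closure (S ` cball 0 1))" using S by (simp add: compact_ops_def)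
  then have "\<exists>k. finite k \<and> closure (S ` cball 0 1) \<subseteq> (\<Union>y\<in>k. ball y (\<epsilon>/2))"
    using \<open>\<epsilon> > 0\<close> unfolding compact_eq_totally_bounded by simp
  then obtain k where k: "finite k" "S ` cball 0 1 \<subseteq> (\<Union>y\<in>k. ball y (\<epsilon>/2))"
    using closure_subset[of "S ` cball 0 1"] by blast
  have "\<exists>F. finite F \<and> F \<subseteq> E \<and> norm (y - (\<Sum>f\<in>F. cinner f y *\<^sub>C f)) < \<epsilon>/2" for y
    using onb_approx[OF E, of "\<epsilon>/2" y] \<open>\<epsilon> > 0\<close> by (metis half_gt_zero)
  then obtain G where G: "\<And>y. finite (G y)" "\<And>y. G y \<subseteq> E"
    "\<And>y. norm (y - (\<Sum>f\<in>G y. cinner f y *\<^sub>C f)) < \<epsilon>/2" by metis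
  define F where "F = (\<Union>y\<in>k. G y)"
  have F: "finite F" "F \<subseteq> E" using k(1) G by (auto simp: F_def)
  define Q where "Q y = y - (\<Sum>f\<in>F. cinner f y *\<^sub>C f)" for y
  have Q: "Q (x + y) = Q x + Q y" "Q (r *\<^sub>R x) = r *\<^sub>R Q x" for x y r
    by (simp_all add: Q_def cinner_add_right scaleC_add_left sum.distrib cinner.scaleR_right
        scaleC.scaleR_left scaleR_diff_right scaleR_sum_right)
  have ball: "norm (Q (S x)) \<le> \<epsilon>" if x: "norm x \<le> 1" for x
  proof -
    obtain y where y: "y \<in> k" "dist y (S x) < \<epsilon>/2"
      using subsetD[OF k(2) imageI[of x]] x by (auto simp: mem_ball)
    have "norm (Q (S x - y)) \<le> norm (S x - y)"
      unfolding Q_def by (rule norm_diff_projection_le[OF on F])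
    moreover have "norm (Q y) < \<epsilon>/2"
    proof -
      have "G y \<subseteq> F" using y(1) by (auto simp: F_def)
      then show ?thesis
        using norm_diff_projection_mono[OF on F, of "G y" y] G(3)[of y] by (simp add: Q_def)
    qed
    moreover have "norm (Q (S x)) \<le> norm (Q (S x - y)) + norm (Q y)"
      using norm_triangle_ineq[of "Q (S x - y)" "Q y"] by (simp add: Q(1)[symmetric])
    ultimately show ?thesis using y(2) by (simp add: dist_norm norm_minus_commute)
  qed
  have "norm (Q (S x)) \<le> \<epsilon> * norm x" for x
  proof (cases "x = 0")
    case False
    have "norm (Q (S (inverse (norm x) *\<^sub>R x))) \<le> \<epsilon>" using False by (intro ball) simp
    then show ?thesis using False by (simp add: S.scaleR Q(2) field_simps)
  qed (simp add: S.zero Q_def cinner.zero_right scaleC.zero_left)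
  then show thesis using that F by (simp add: Q_def)
qed

text \<open>The finite-rank part of \<open>S\<close> contributes finitely many matrix elements,
  which converge weakly; the remainder of norm at most \<delta> contributes at most \<delta> M,
  uniformly along the sequence.\<close>

lemma tr_tendsto:
  fixes \<rho> :: "nat \<Rightarrow> 'a::complex_hilbert \<Rightarrow> 'a"
  assumes B: "\<And>n. is_eigenbasis (\<rho> n) (B n)" "is_eigenbasis \<rho>' B'"
    and M: "\<And>n. trace_le (\<rho> n) M" "trace_le \<rho>' M"
    and wk: "\<And>x y. (\<lambda>n. cinner x (\<rho> n y)) \<longlonglongrightarrow> cinner x (\<rho>' y)"
    and S: "S \<in> compact_ops"
  shows "(\<lambda>n. tr (\<rho> n \<circ> S)) \<longlonglongrightarrow> tr (\<rho>' \<circ> S)"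
proof (rule tendsto_uniform_approx)
  fix \<epsilon> :: real assume "\<epsilon> > 0"
  have M0: "M \<ge> 0" using trace_le_nonneg[OF M(2)] .
  define \<delta> where "\<delta> = \<epsilon> / (M + 1)"
  have \<delta>: "\<delta> > 0" "\<delta> * M \<le> \<epsilon>"
    using \<open>\<epsilon> > 0\<close> M0 by (auto simp: \<delta>_def divide_simps mult_left_mono)
  have Sl: "bounded_clinear S" using S by (simp add: compact_ops_def)
  then interpret S: bounded_linear S by (simp add: bounded_clinear_def)
  have on: "orthonormal (some_onb :: 'a set)"
    using is_onb_some_onb[where ?'a = 'a] by (simp add: is_onb_iff)
  obtain K where K: "K > 0" "\<And>x. norm (S x) \<le> K * norm x"
    using S.pos_bounded by (auto simp: mult.commute)
  obtain F where F: "finite F" "F \<subseteq> some_onb"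
    and app: "\<And>x. norm (S x - (\<Sum>f\<in>F. cinner f (S x) *\<^sub>C f)) \<le> \<delta> * norm x"
    using compact_op_finite_rank_approx[OF S is_onb_some_onb \<delta>(1)] by metis
  define R where "R x = S x - (\<Sum>f\<in>F. cinner f (S x) *\<^sub>C f)" for x
  have R: "bounded_clinear R"
    unfolding bounded_clinear_def R_def
  proof (intro conjI allI)
    show "bounded_linear (\<lambda>x. S x - (\<Sum>f\<in>F. cinner f (S x) *\<^sub>C f))"
      by (intro bounded_linear_sub bounded_linear_sum S.bounded_linear_axioms
          bounded_linear_compose[OF scaleC.bounded_linear_left]
          bounded_linear_compose[OF cinner.bounded_linear_right])
    show "S (c *\<^sub>C x) - (\<Sum>f\<in>F. cinner f (S (c *\<^sub>C x)) *\<^sub>C f)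
        = c *\<^sub>C (S x - (\<Sum>f\<in>F. cinner f (S x) *\<^sub>C f))" for c x
      using Sl by (simp add: bounded_clinear_def cinner_scaleC_right scaleC.diff_right
          scaleC.sum_right scaleC_scaleC)
  qed
  \<comment> \<open>By Parseval, the finite sum is the trace of \<open>A\<close> composed with the
    projection of \<open>S\<close> onto the span of \<open>F\<close>; the error is the trace of
    \<open>A\<close> composed with \<open>R\<close>.\<close>
  have approx: "cmod (tr (A \<circ> S) - (\<Sum>f\<in>F. cinner f (S (A f)))) \<le> \<epsilon>"
    if BA: "is_eigenbasis A B''" and MA: "trace_le A M" for A :: "'a \<Rightarrow> 'a" and B''
  proof -
    have A: "positive_op A" using MA by (simp add: trace_le_def)
    interpret A: bounded_linear A using A by (rule positive_op_bounded_linear)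
    have "((\<lambda>e. cinner f (S e) * cinner e (A f)) has_sum cinner f (S (A f))) some_onb" for f
    proof -
      obtain w where w: "\<And>x. cinner f (S x) = cinner w x"
        using bounded_clinear_functional[OF Sl] by blast
      show ?thesis unfolding w by (rule parseval_cinner[OF is_onb_some_onb])
    qed
    then have fin: "((\<lambda>e. \<Sum>f\<in>F. cinner f (S e) * cinner e (A f)) has_sum (\<Sum>f\<in>F. cinner f (S (A f)))) some_onb"
      by (rule has_sum_finite_sum)
    have full: "((\<lambda>e. cinner e (A (S e))) has_sum tr (A \<circ> S)) some_onb"
      using abs_summable_summable[OF trace_le_mult(1)[OF BA MA Sl K(2) less_imp_le[OF K(1)] on]]
      by (simp add: tr_def)
    have "((\<lambda>e. cinner e (A (S e)) - (\<Sum>f\<in>F. cinner f (S e) * cinner e (A f))) has_sum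
        tr (A \<circ> S) - (\<Sum>f\<in>F. cinner f (S (A f)))) some_onb"
      using has_sum_add[OF full has_sum_cmult_right[OF fin, of "-1"]] by simp
    moreover have "cinner e (A (S e)) - (\<Sum>f\<in>F. cinner f (S e) * cinner e (A f)) = cinner e (A (R e))" for e
      by (simp add: R_def A.diff A.sum positive_op_scaleC[OF A] cinner.diff_right cinner.sum_right
          cinner_scaleC_right)
    ultimately have "(\<Sum>\<^sub>\<infinity>e\<in>some_onb. cinner e (A (R e))) = tr (A \<circ> S) - (\<Sum>f\<in>F. cinner f (S (A f)))"
      by (simp add: infsumI)
    then show ?thesis
      using trace_le_mult(2)[OF BA MA R _ _ on, of \<delta>] app \<delta> by (simp add: R_def)
  qed
  have "(\<lambda>n. \<Sum>f\<in>F. cinner f (S (\<rho> n f))) \<longlonglongrightarrow> (\<Sum>f\<in>F. cinner f (S (\<rho>' f)))"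
  proof (intro tendsto_sum)
    fix f :: 'a
    obtain w where w: "\<And>x. cinner f (S x) = cinner w x"
      using bounded_clinear_functional[OF Sl] by blast
    show "(\<lambda>n. cinner f (S (\<rho> n f))) \<longlonglongrightarrow> cinner f (S (\<rho>' f))" unfolding w by (rule wk)
  qed
  then show "\<exists>b m. b \<longlonglongrightarrow> m \<and> (\<forall>n. cmod (tr (\<rho> n \<circ> S) - b n) \<le> \<epsilon>) \<and> cmod (tr (\<rho>' \<circ> S) - m) \<le> \<epsilon>"
    using approx[OF B(1) M(1)] approx[OF B(2) M(2)] by blast
qed

text \<open>It is enough to test subbasic sets: eventual membership passes to finite intersections
  and to unions.\<close>

lemma limitin_weak_star:
  assumes "l \<in> trace_class" "\<And>n. f n \<in> trace_class"
    and "\<And>S. S \<in> compact_ops \<Longrightarrow> (\<lambda>n. tr (f n \<circ> S)) \<longlonglongrightarrow> tr (l \<circ> S)"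
  shows "limitin weak_star f l sequentially"
  unfolding limitin_def topspace_weak_star
proof (intro conjI allI impI assms(1))
  fix U assume U: "openin weak_star U \<and> l \<in> U"
  let ?S = "{{\<rho> \<in> trace_class. tr (\<rho> \<circ> \<sigma>) \<in> U} | \<sigma> U. \<sigma> \<in> compact_ops \<and> open U}"
  have "generate_topology_on ?S U"
    using U by (simp add: weak_star_def openin_topology_generated_by_iff)
  then have "l \<in> U \<longrightarrow> eventually (\<lambda>n. f n \<in> U) sequentially"
  proof induction
    case (Int a b)
    then show ?case by (auto intro: eventually_conj)
  next
    case (UN K)
    show ?case
    proof
      assume "l \<in> \<Union>K"
      then obtain k where k: "k \<in> K" "l \<in> k" by blast
      then have "eventually (\<lambda>n. f n \<in> k) sequentially" using UN by blast
      then show "eventually (\<lambda>n. f n \<in> \<Union>K) sequentially"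
        by (rule eventually_mono) (use k in blast)
    qed
  next
    case (Basis s)
    then obtain \<sigma> V where s: "s = {\<rho> \<in> trace_class. tr (\<rho> \<circ> \<sigma>) \<in> V}" "\<sigma> \<in> compact_ops" "open V"
      by blast
    show ?case
      using topological_tendstoD[OF assms(3)[OF s(2)] s(3)] assms(2) by (simp add: s(1))
  qed simp
  then show "eventually (\<lambda>n. f n \<in> U) sequentially" using U by blast
qed

section \<open>Weak sequential compactness of operators of bounded trace\<close>

lemma (in separable_hilbert) trace_le_eigenbasis:
  "trace_le A M \<Longrightarrow> is_eigenbasis A (some_eigenbasis (A :: 'a \<Rightarrow> 'a))"
  by (rule is_eigenbasis_some_eigenbasis[OF trace_le_positive_trace_class])

lemma (in separable_hilbert) trace_le_compact:
  fixes \<rho> :: "nat \<Rightarrow> 'a \<Rightarrow> 'a"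
  assumes M: "\<And>n. trace_le (\<rho> n) M"
  obtains r \<rho>' where "strict_mono (r :: nat \<Rightarrow> nat)" "trace_le \<rho>' M"
    "\<And>x y. (\<lambda>n. cinner x (\<rho> (r n) y)) \<longlonglongrightarrow> cinner x (\<rho>' y)"
proof -
  obtain E :: "'a set" where E: "is_onb E" using exists_onb by blast
  have norm1: "norm e = 1" if "e \<in> E" for e using E that by (simp add: is_onb_def)
  have pos: "positive_op (\<rho> n)" for n using M by (simp add: trace_le_def)
  have bd: "norm (\<rho> n x) \<le> M * norm x" for n x
    by (rule trace_le_norm[OF trace_le_eigenbasis[OF M] M])
  have "cmod (case p of (e, e') \<Rightarrow> cinner e (\<rho> n e')) \<le> M" if p: "p \<in> E \<times> E" for n p
  proof -
    obtain e e' where ee: "p = (e, e')" "e \<in> E" "e' \<in> E" using p by blast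
    have "cmod (cinner e (\<rho> n e')) \<le> norm e * norm (\<rho> n e')" by (rule cmod_cinner_le)
    also have "\<dots> \<le> M" using norm1 ee bd[of n e'] by simp
    finally show ?thesis using ee by simp
  qed
  moreover have "countable (E \<times> E)" using countable_onb[OF E] by blast
  ultimately obtain r where r: "strict_mono (r :: nat \<Rightarrow> nat)"
    and cr: "\<And>p. p \<in> E \<times> E \<Longrightarrow> \<exists>l. (\<lambda>n. case p of (e, e') \<Rightarrow> cinner e (\<rho> (r n) e')) \<longlonglongrightarrow> l"
    using function_convergent_subsequence[of "E \<times> E" "\<lambda>n p. case p of (e, e') \<Rightarrow> cinner e (\<rho> n e')" M]
    by metis
  have basis: "convergent (\<lambda>n. cinner x (\<rho> (r n) e))" if "e \<in> E" for x e
  proof -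
    have "convergent (\<lambda>n. cinner f (\<rho> (r n) e))" if "f \<in> E" for f
      using cr[of "(f, e)"] that \<open>e \<in> E\<close> by (auto simp: convergent_def)
    then obtain z where "\<And>x. (\<lambda>n. cinner x (\<rho> (r n) e)) \<longlonglongrightarrow> cinner x z"
      using weak_limit[OF E, of "\<lambda>n. \<rho> (r n) e" "M * norm e"] bd by metis
    then show ?thesis by (auto simp: convergent_def)
  qed
  have "\<exists>z. norm z \<le> M * norm y \<and> (\<forall>x. (\<lambda>n. cinner x (\<rho> (r n) y)) \<longlonglongrightarrow> cinner x z)" for y
  proof -
    \<comment> \<open>Symmetry moves the operator onto the basis vector, where convergence against
      arbitrary vectors is already known.\<close>
    have "convergent (\<lambda>n. cinner e (\<rho> (r n) y))" if e: "e \<in> E" for e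
    proof -
      have "(\<lambda>n. cinner e (\<rho> (r n) y)) = (\<lambda>n. cnj (cinner y (\<rho> (r n) e)))"
        by (intro ext) (metis positive_op_symmetric[OF pos] cinner_commute)
      moreover obtain l where "(\<lambda>n. cinner y (\<rho> (r n) e)) \<longlonglongrightarrow> l"
        using basis[OF e, of y] by (auto simp: convergent_def)
      ultimately show ?thesis using tendsto_cnj[of _ l sequentially] by (auto simp: convergent_def)
    qed
    then show ?thesis
      using weak_limit[OF E, of "\<lambda>n. \<rho> (r n) y" "M * norm y"] bd by metis
  qed
  then obtain \<rho>' where nr: "\<And>y. norm (\<rho>' y) \<le> M * norm y"
    and wk: "\<And>x y. (\<lambda>n. cinner x (\<rho> (r n) y)) \<longlonglongrightarrow> cinner x (\<rho>' y)" by metis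
  \<comment> \<open>The limit was chosen separately for each y; linearity is recovered from
    uniqueness of weak limits.\<close>
  have add: "\<rho>' (x + y) = \<rho>' x + \<rho>' y" for x y
  proof (rule cinner_ext)
    fix z
    have "(\<lambda>n. cinner z (\<rho> (r n) (x + y))) \<longlonglongrightarrow> cinner z (\<rho>' x) + cinner z (\<rho>' y)"
      using tendsto_add[OF wk[of z x] wk[of z y]]
      by (simp add: linear_add[OF bounded_linear.linear[OF positive_op_bounded_linear[OF pos]]] cinner_add_right)
    then show "cinner z (\<rho>' (x + y)) = cinner z (\<rho>' x + \<rho>' y)"
      using LIMSEQ_unique[OF wk] by (simp add: cinner_add_right)
  qed
  have scale: "\<rho>' (c *\<^sub>C x) = c *\<^sub>C \<rho>' x" for c x
  proof (rule cinner_ext)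
    fix z
    have "(\<lambda>n. cinner z (\<rho> (r n) (c *\<^sub>C x))) \<longlonglongrightarrow> c * cinner z (\<rho>' x)"
      using tendsto_mult[OF tendsto_const wk[of z x]]
      by (simp add: positive_op_scaleC[OF pos] cinner_scaleC_right)
    then show "cinner z (\<rho>' (c *\<^sub>C x)) = cinner z (c *\<^sub>C \<rho>' x)"
      using LIMSEQ_unique[OF wk] by (simp add: cinner_scaleC_right)
  qed
  have "bounded_linear \<rho>'"
    by (rule bounded_linear_intro[of _ M])
      (use add scale[of "complex_of_real _"] nr in \<open>auto simp: scaleC_of_real mult.commute\<close>)
  then have bcl: "bounded_clinear \<rho>'" by (simp add: bounded_clinear_def scale)
  have ev: "(\<lambda>n. eigval (\<rho> (r n)) x) \<longlonglongrightarrow> eigval \<rho>' x" for x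
    unfolding eigval_def by (intro tendsto_intros wk)
  have "positive_op \<rho>'"
  proof (rule positive_opI[OF bcl])
    fix x
    have "(\<lambda>n. Im (cinner x (\<rho> (r n) x))) \<longlonglongrightarrow> Im (cinner x (\<rho>' x))" by (intro tendsto_intros wk)
    then show "Im (cinner x (\<rho>' x)) = 0"
      by (simp add: cinner_eigval[OF pos] LIMSEQ_const_iff)
    show "eigval \<rho>' x \<ge> 0"
      by (rule LIMSEQ_le_const[OF ev]) (use eigval_nonneg[OF pos] in blast)
  qed
  moreover have "(\<Sum>e\<in>F. eigval \<rho>' e) \<le> M" if "finite F" "orthonormal F" for F
  proof (rule LIMSEQ_le_const2)
    show "(\<lambda>n. \<Sum>e\<in>F. eigval (\<rho> (r n)) e) \<longlonglongrightarrow> (\<Sum>e\<in>F. eigval \<rho>' e)" by (intro tendsto_intros ev)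
    show "\<exists>N. \<forall>n\<ge>N. (\<Sum>e\<in>F. eigval (\<rho> (r n)) e) \<le> M" using M that by (simp add: trace_le_def)
  qed
  ultimately have "trace_le \<rho>' M" by (simp add: trace_le_def)
  then show thesis using that r wk by blast
qed

section \<open>Countable sums as integrals over counting measures, as Tonelli and Fatou
  require\<close>

lemma infsum_eq_nn_integral:
  fixes f :: "'a \<Rightarrow> ennreal"
  assumes "countable A" shows "infsum f A = (\<integral>\<^sup>+x. f x \<partial>count_space A)"
proof (cases "finite A")
  case True then show ?thesis by (simp add: nn_integral_count_space_finite)
next
  case False
  define g where "g = from_nat_into A"
  have g: "bij_betw g UNIV A" using bij_betw_from_nat_into[OF assms False] by (simp add: g_def)
  have "infsum f A = infsum (\<lambda>n. f (g n)) UNIV" by (rule infsum_reindex_bij_betw[OF g, symmetric])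
  also have "\<dots> = (\<Sum>n. f (g n))"
    by (intro sums_unique has_sum_imp_sums has_sum_infsum nonneg_summable_on_complete) simp
  also have "\<dots> = (\<integral>\<^sup>+x. f x \<partial>count_space A)"
    unfolding nn_integral_count_space_nat[symmetric] by (rule nn_integral_bij_count_space[OF g])
  finally show ?thesis .
qed

lemma sum_le_nn_integral_count_space:
  fixes f :: "'a \<Rightarrow> ennreal"
  assumes "countable A" "finite F" "F \<subseteq> A"
  shows "sum f F \<le> (\<integral>\<^sup>+x. f x \<partial>count_space A)"
  unfolding infsum_eq_nn_integral[OF assms(1), symmetric]
  using assms by (subst nonneg_infsum_complete) (auto intro: SUP_upper2)

text \<open>The signs of \<open>u\<close> and \<open>v\<close> are left open, because the summands
  of \<open>resolvent_bound\<close> may be negative; truncation by \<open>ennreal\<close> can only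
  raise the right-hand side.\<close>

lemma has_sum_le_nn_integral:
  fixes u v :: "'a \<Rightarrow> real"
  assumes A: "countable A" and v: "(v has_sum L) A" and le: "\<And>a. a \<in> A \<Longrightarrow> v a \<le> u a"
  shows "ennreal L \<le> (\<integral>\<^sup>+a. ennreal (u a) \<partial>count_space A)"
proof (rule tendsto_upperbound)
  show "((\<lambda>F. ennreal (sum v F)) \<longlongrightarrow> ennreal L) (finite_subsets_at_top A)"
    using v by (intro tendsto_ennrealI) (simp add: has_sum_def)
  have "ennreal (sum v F) \<le> (\<integral>\<^sup>+a. ennreal (u a) \<partial>count_space A)" if F: "finite F" "F \<subseteq> A" for F
  proof -
    have "ennreal (sum v F) \<le> ennreal (\<Sum>a\<in>F. max 0 (u a))"
      using le F by (intro ennreal_leI sum_mono) (meson max.coboundedI2 subsetD)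
    also have "\<dots> = (\<Sum>a\<in>F. ennreal (u a))"
    proof -
      have "ennreal (max 0 (u a)) = ennreal (u a)" for a by (auto simp: max_def ennreal_neg)
      then show ?thesis by (subst sum_ennreal[symmetric]) auto
    qed
    also have "\<dots> \<le> (\<integral>\<^sup>+a. ennreal (u a) \<partial>count_space A)"
      by (rule sum_le_nn_integral_count_space[OF A F])
    finally show ?thesis .
  qed
  then show "\<forall>\<^sub>F F in finite_subsets_at_top A. ennreal (sum v F) \<le> (\<integral>\<^sup>+a. ennreal (u a) \<partial>count_space A)"
    by (auto intro: eventually_finite_subsets_at_top_weakI)
qed simp

lemma nn_integral_le_finite_sums:
  fixes u :: "'a \<Rightarrow> real"
  assumes A: "countable A" and nn: "\<And>a. a \<in> A \<Longrightarrow> 0 \<le> u a"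
    and M: "\<And>F. finite F \<Longrightarrow> F \<subseteq> A \<Longrightarrow> sum u F \<le> M"
  shows "(\<integral>\<^sup>+a. ennreal (u a) \<partial>count_space A) \<le> ennreal M"
  unfolding infsum_eq_nn_integral[OF A, symmetric]
proof (rule infsum_le_finite_sums)
  fix F assume F: "finite F" "F \<subseteq> A"
  then have "(\<Sum>a\<in>F. ennreal (u a)) = ennreal (sum u F)"
    using nn by (intro sum_ennreal) auto
  then show "(\<Sum>a\<in>F. ennreal (u a)) \<le> ennreal M" using M[OF F] by (simp add: ennreal_leI)
qed (simp add: nonneg_summable_on_complete)

lemma nn_integral_has_sum:
  fixes u :: "'a \<Rightarrow> real"
  assumes A: "countable A" and nn: "\<And>a. a \<in> A \<Longrightarrow> 0 \<le> u a" and u: "(u has_sum L) A"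
  shows "(\<integral>\<^sup>+a. ennreal (u a) \<partial>count_space A) = ennreal L"
proof (rule antisym)
  show "(\<integral>\<^sup>+a. ennreal (u a) \<partial>count_space A) \<le> ennreal L"
    using A nn by (rule nn_integral_le_finite_sums) (auto intro: finite_sum_le_has_sum[OF u] nn)
  show "ennreal L \<le> (\<integral>\<^sup>+a. ennreal (u a) \<partial>count_space A)"
    by (rule has_sum_le_nn_integral[OF A u]) simp
qed

lemma
  fixes f :: "'a \<Rightarrow> 'b \<Rightarrow> ennreal"
  assumes A: "countable A" and B: "countable B"
  shows nn_integral_count_space_fst: "(\<integral>\<^sup>+(a, b). f a b \<partial>count_space (A \<times> B)) =
      (\<integral>\<^sup>+a. \<integral>\<^sup>+b. f a b \<partial>count_space B \<partial>count_space A)"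
    and nn_integral_count_space_snd: "(\<integral>\<^sup>+(a, b). f a b \<partial>count_space (A \<times> B)) =
      (\<integral>\<^sup>+b. \<integral>\<^sup>+a. f a b \<partial>count_space A \<partial>count_space B)"
proof -
  interpret B: sigma_finite_measure "count_space B" by (rule sigma_finite_measure_count_space_countable[OF B])
  show *: "(\<integral>\<^sup>+(a, b). f a b \<partial>count_space (A \<times> B)) =
      (\<integral>\<^sup>+a. \<integral>\<^sup>+b. f a b \<partial>count_space B \<partial>count_space A)"
    using B.nn_integral_fst[of "\<lambda>(a, b). f a b" "count_space A"]
    by (simp add: pair_measure_countable[OF A B])
  show "(\<integral>\<^sup>+(a, b). f a b \<partial>count_space (A \<times> B)) =
      (\<integral>\<^sup>+b. \<integral>\<^sup>+a. f a b \<partial>count_space A \<partial>count_space B)"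
    unfolding * by (rule nn_integral_count_space_nn_integral[OF B]) simp
qed

section \<open>Relative entropy\<close>

text \<open>Integrating s / (1 + t) - s / (s + t) over t > 0 gives s ln s, and 1 / (1 + t)^2
  integrates to 1. The subtracted middle term is the tangent at s = 1 of the first expression, which
  is convex in s; this is why the kernel is nonnegative.\<close>

definition ent_kernel :: "real \<Rightarrow> real \<Rightarrow> real" where
  "ent_kernel s t = s / (1 + t) - (s - 1) / (1 + t)\<^sup>2 - s / (s + t)"

text \<open>The first form separates a part affine in s from the resolvent t / (s + t); the second
  displays the sign.\<close>

lemma ent_kernel_eq:
  assumes "s \<ge> 0" "t > 0"
  shows "ent_kernel s t = (s * t + 1) / (1 + t)\<^sup>2 - 1 + t / (s + t)"
    and "ent_kernel s t = t * (s - 1)\<^sup>2 / ((s + t) * (1 + t)\<^sup>2)"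
proof -
  have nz: "1 + t \<noteq> 0" "s + t \<noteq> 0" using assms by auto
  have 1: "s / (1 + t) = s * (1 + t) / (1 + t)\<^sup>2" using nz by (simp add: power2_eq_square)
  have 2: "s / (s + t) = 1 - t / (s + t)" using nz by (simp add: field_simps)
  show eq: "ent_kernel s t = (s * t + 1) / (1 + t)\<^sup>2 - 1 + t / (s + t)"
    unfolding ent_kernel_def 1 2 by (simp add: diff_divide_distrib[symmetric] algebra_simps)
  show "ent_kernel s t = t * (s - 1)\<^sup>2 / ((s + t) * (1 + t)\<^sup>2)"
  proof -
    have "(s * t + 1) / (1 + t)\<^sup>2 - 1 + t / (s + t)
        = ((s * t + 1) * (s + t) - (1 + t)\<^sup>2 * (s + t) + t * (1 + t)\<^sup>2) / ((s + t) * (1 + t)\<^sup>2)"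
      using nz by (simp add: add_divide_distrib diff_divide_distrib)
    also have "(s * t + 1) * (s + t) - (1 + t)\<^sup>2 * (s + t) + t * (1 + t)\<^sup>2 = t * (s - 1)\<^sup>2"
      by (simp add: power2_eq_square algebra_simps)
    finally show ?thesis unfolding eq .
  qed
qed

lemma ent_kernel_nonneg: "s \<ge> 0 \<Longrightarrow> t > 0 \<Longrightarrow> ent_kernel s t \<ge> 0"
  by (simp add: ent_kernel_eq(2))

lemma borel_measurable_ent_kernel [measurable]: "ent_kernel s \<in> borel_measurable borel"
  unfolding ent_kernel_def[abs_def] by measurable

lemma ent_kernel_integral:
  assumes s: "s \<ge> 0"
  shows "(\<integral>\<^sup>+t. ennreal (ent_kernel s t) * indicator {0<..} t \<partial>lborel) = ennreal (1 - s + s * ln s)"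
proof -
  \<comment> \<open>An antiderivative that vanishes at infinity, since the logarithms combine to
    that of a quotient tending to 1. The integral is therefore -F 0.\<close>
  define F where "F t = s * ln (1 + t) + (s - 1) / (1 + t) - s * ln (s + t)" for t :: real
  have F_lim: "(F \<longlongrightarrow> 0) at_top"
  proof -
    have inf: "filterlim (\<lambda>t. c + t) at_infinity at_top" for c :: real
      by (intro filterlim_at_top_imp_at_infinity filterlim_tendsto_add_at_top[OF tendsto_const filterlim_ident])
    have "((\<lambda>t. s * ln (1 + (1 - s) / (s + t)) + (s - 1) / (1 + t)) \<longlongrightarrow> s * ln (1 + 0) + 0) at_top"
      by (intro tendsto_intros tendsto_divide_0[OF tendsto_const inf]) simp
    then have "((\<lambda>t. s * ln (1 + (1 - s) / (s + t)) + (s - 1) / (1 + t)) \<longlongrightarrow> 0) at_top" by simp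
    moreover have "eventually (\<lambda>t. s * ln (1 + (1 - s) / (s + t)) + (s - 1) / (1 + t) = F t) at_top"
      using eventually_gt_at_top[of 0]
    proof eventually_elim
      case (elim t)
      have "1 + (1 - s) / (s + t) = (1 + t) / (s + t)" using s elim by (simp add: field_simps)
      then have "ln (1 + (1 - s) / (s + t)) = ln (1 + t) - ln (s + t)"
        using s elim by (simp add: ln_div)
      then show ?case by (simp add: F_def right_diff_distrib)
    qed
    ultimately show ?thesis by (rule Lim_transform_eventually)
  qed
  have "(\<integral>\<^sup>+t. ennreal (ent_kernel s t) * indicator {0<..} t \<partial>lborel)
      = (\<integral>\<^sup>+t. ennreal (ent_kernel s t) * indicator {0..} t \<partial>lborel)"
    using AE_lborel_singleton[of "0::real"]
    by (intro nn_integral_cong_AE) (auto simp: indicator_def)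
  also have "\<dots> = ennreal (0 - F 0)"
  proof (rule nn_integral_FTC_atLeast[OF borel_measurable_ent_kernel _ _ F_lim])
    fix t :: real assume t: "0 \<le> t"
    show "(F has_real_derivative ent_kernel s t) (at t)"
    \<comment> \<open>For s = 0 the argument of the second logarithm vanishes at t = 0. Its factor s
      removes it from \<open>F\<close>, and the default 0 / 0 = 0 gives the kernel the matching
      value 1.\<close>
    proof (cases "s = 0")
      case True
      then show ?thesis using t unfolding F_def ent_kernel_def
        by (auto intro!: derivative_eq_intros simp: power2_eq_square)
    next
      case False
      then show ?thesis using t s unfolding F_def ent_kernel_def
        by (auto intro!: derivative_eq_intros simp: power2_eq_square diff_divide_distrib)
    qed
    show "0 \<le> ent_kernel s t"
    proof (cases "t = 0")
      case True then show ?thesis by (simp add: ent_kernel_def)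
    qed (use ent_kernel_nonneg s t in auto)
  qed
  also have "0 - F 0 = 1 - s + s * ln s" by (simp add: F_def)
  finally show ?thesis .
qed

definition rel_ent :: "real \<Rightarrow> real \<Rightarrow> real" where
  "rel_ent l m = m - l + l * ln l - l * ln m"

lemma rel_ent_eq: "l \<ge> 0 \<Longrightarrow> m > 0 \<Longrightarrow> rel_ent l m = m * (1 - l / m + l / m * ln (l / m))"
  by (cases "l = 0") (simp_all add: rel_ent_def ln_div field_simps)

lemma rel_ent_integral:
  assumes "l \<ge> 0" "m > 0" "c \<ge> 0"
  shows "(\<integral>\<^sup>+t. ennreal (c * (m * ent_kernel (l / m) t)) * indicator {0<..} t \<partial>lborel) = ennreal (c * rel_ent l m)"
proof -
  have "(\<integral>\<^sup>+t. ennreal (c * (m * ent_kernel (l / m) t)) * indicator {0<..} t \<partial>lborel)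
      = (\<integral>\<^sup>+t. ennreal (c * m) * (ennreal (ent_kernel (l / m) t) * indicator {0<..} t) \<partial>lborel)"
    using assms by (intro nn_integral_cong) (auto simp: ennreal_mult'[symmetric] mult_ac split: split_indicator)
  also have "\<dots> = ennreal (c * m) * ennreal (1 - l / m + l / m * ln (l / m))"
    using assms by (subst nn_integral_cmult) (auto simp: ent_kernel_integral)
  also have "\<dots> = ennreal (c * rel_ent l m)"
    using assms by (simp add: rel_ent_eq ennreal_mult'[symmetric] mult_ac)
  finally show ?thesis .
qed

text \<open>The term (e - 1) m is the maximum over l of \<open>l - rel_ent l m\<close>, attained at
  l = e m; accordingly the logarithm is bounded by its tangent with argument e m / l.\<close>

lemma rel_ent_lower_bound:
  assumes "l \<ge> 0" "m > 0" shows "l \<le> (exp 1 - 1) * m + rel_ent l m"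
proof (cases "l = 0")
  case True then show ?thesis using assms by (simp add: rel_ent_def)
next
  case False
  then have l: "l > 0" using assms by simp
  have "ln (exp 1 * m / l) \<le> exp 1 * m / l - 1"
    using assms l by (intro ln_le_minus_one) simp
  then have "1 + ln m - ln l \<le> exp 1 * m / l - 1"
    using assms l by (simp add: ln_div ln_mult)
  then have "l * (1 + ln m - ln l) \<le> l * (exp 1 * m / l - 1)"
    using l by (intro mult_left_mono) auto
  then show ?thesis using l by (simp add: rel_ent_def algebra_simps)
qed

text \<open>The squared overlaps are the spectral weights of \<open>A\<close> at \<open>b\<close>,
  so for m > 0 this is the diagonal element at \<open>b\<close> of the function
  \<open>rel_ent _ m\<close> of \<open>A\<close>. With \<open>b\<close> and \<open>m\<close> from
  \<open>\<rho>\<^sub>0\<close> it is the share of \<open>b\<close> in the relative entropy.\<close>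

definition entropy_slice :: "('a::complex_hilbert \<Rightarrow> 'a) \<Rightarrow> 'a set \<Rightarrow> 'a \<Rightarrow> real \<Rightarrow> ennreal" where
  "entropy_slice A B b m =
     (\<integral>\<^sup>+a. ennreal ((cmod (cinner a b))\<^sup>2 * rel_ent (eigval A a) m) \<partial>count_space B)"

definition resolvent_slice :: "('a::complex_hilbert \<Rightarrow> 'a) \<Rightarrow> 'a set \<Rightarrow> 'a \<Rightarrow> real \<Rightarrow> real \<Rightarrow> ennreal" where
  "resolvent_slice A B b m t =
     (\<integral>\<^sup>+a. ennreal ((cmod (cinner a b))\<^sup>2 * (m * ent_kernel (eigval A a / m) t)) \<partial>count_space B)"

lemma entropy_slice_eq_integral:
  assumes A: "positive_op A" and B: "countable B" and m: "m > 0"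
  shows "entropy_slice A B b m = (\<integral>\<^sup>+t. resolvent_slice A B b m t * indicator {0<..} t \<partial>lborel)"
proof -
  have "entropy_slice A B b m = (\<integral>\<^sup>+a. \<integral>\<^sup>+t. ennreal ((cmod (cinner a b))\<^sup>2 *
      (m * ent_kernel (eigval A a / m) t)) * indicator {0<..} t \<partial>lborel \<partial>count_space B)"
    unfolding entropy_slice_def using eigval_nonneg[OF A] m by (simp add: rel_ent_integral)
  also have "\<dots> = (\<integral>\<^sup>+t. \<integral>\<^sup>+a. ennreal ((cmod (cinner a b))\<^sup>2 *
      (m * ent_kernel (eigval A a / m) t)) * indicator {0<..} t \<partial>count_space B \<partial>lborel)"
    by (rule nn_integral_count_space_nn_integral[OF B, symmetric]) measurable
  also have "\<dots> = (\<integral>\<^sup>+t. resolvent_slice A B b m t * indicator {0<..} t \<partial>lborel)"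
    unfolding resolvent_slice_def by (intro nn_integral_cong nn_integral_multc) simp
  finally show ?thesis .
qed

lemma borel_measurable_resolvent_slice:
  assumes B: "countable B"
  shows "resolvent_slice A B b m \<in> borel_measurable lborel"
proof -
  interpret B: sigma_finite_measure "count_space B" by (rule sigma_finite_measure_count_space_countable[OF B])
  let ?f = "\<lambda>(a, t). ennreal ((cmod (cinner a b))\<^sup>2 * (m * ent_kernel (eigval A a / m) t))"
  have "?f \<in> borel_measurable (count_space B \<Otimes>\<^sub>M lborel)"
    by (rule measurable_pair_measure_countable1[OF B]) simp
  from measurable_pair_swap[OF this]
  have "(\<lambda>(t, a). ennreal ((cmod (cinner a b))\<^sup>2 * (m * ent_kernel (eigval A a / m) t)))
      \<in> borel_measurable (lborel \<Otimes>\<^sub>M count_space B)"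
    by simp
  from B.borel_measurable_nn_integral[OF this] show ?thesis
    unfolding resolvent_slice_def[abs_def] by simp
qed

text \<open>
  As \<open>\<langle>b, (A + m t)\<^sup>-\<^sup>1 b\<rangle>\<close> is the maximum over \<open>y\<close> of
  \<open>2 Re \<langle>y, b\<rangle> - \<langle>y, (A + m t) y\<rangle>\<close>, the value of \<open>resolvent_slice\<close> is the maximum over \<open>y\<close>
  of the following expression, which is weakly continuous in \<open>A\<close>.
\<close>

definition resolvent_bound :: "('a::complex_hilbert \<Rightarrow> 'a) \<Rightarrow> 'a \<Rightarrow> real \<Rightarrow> real \<Rightarrow> 'a \<Rightarrow> real" where
  "resolvent_bound A b m t y = (t * eigval A b + m * (norm b)\<^sup>2) / (1 + t)\<^sup>2 - m * (norm b)\<^sup>2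
     + m\<^sup>2 * t * (2 * inner y b - eigval A y - m * t * (norm y)\<^sup>2)"

lemma resolvent_bound_has_sum:
  assumes B: "is_eigenbasis A B" and A: "positive_op A"
  shows "((\<lambda>a. (t * (eigval A a * (cmod (cinner a b))\<^sup>2) + m * (cmod (cinner a b))\<^sup>2) / (1 + t)\<^sup>2
       - m * (cmod (cinner a b))\<^sup>2
       + m\<^sup>2 * t * (2 * Re (cinner y a * cinner a b) - eigval A a * (cmod (cinner a y))\<^sup>2
           - m * t * (cmod (cinner a y))\<^sup>2)) has_sum resolvent_bound A b m t y) B"
proof -
  have onb: "is_onb B" using B by (simp add: is_eigenbasis_def)
  have diff: "((\<lambda>x. f x - g x) has_sum (u - v)) B" if "(f has_sum u) B" "(g has_sum v) B"
    for f g :: "'a \<Rightarrow> real" and u v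
    using has_sum_add[OF that(1) has_sum_cmult_right[OF that(2), of "-1"]] by simp
  have "((\<lambda>a. Re (cinner y a * cinner a b)) has_sum inner y b) B"
    using has_sum_bounded_linear[OF bounded_linear_Re parseval_cinner[OF onb, of y b]]
    by (simp only: Re_cinner)
  then show ?thesis
    unfolding resolvent_bound_def divide_inverse
    by (intro diff has_sum_add has_sum_cmult_left has_sum_cmult_right eigval_has_sum[OF B A] parseval[OF onb])
qed

text \<open>The variational formula for the resolvent in a single eigendirection, where p = l + m
  t.\<close>

lemma complete_square:
  fixes p :: real and u v :: complex
  assumes "p > 0"
  shows "2 * Re (cnj v * u) - p * (cmod v)\<^sup>2 \<le> (cmod u)\<^sup>2 / p"
    and "v = u / p \<Longrightarrow> 2 * Re (cnj v * u) - p * (cmod v)\<^sup>2 = (cmod u)\<^sup>2 / p"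
proof -
  have "p * (2 * Re (cnj v * u) - p * (cmod v)\<^sup>2) = (cmod u)\<^sup>2 - (cmod (u - p * v))\<^sup>2"
    unfolding cmod_power2 by (simp add: power2_eq_square algebra_simps)
  then have eq: "2 * Re (cnj v * u) - p * (cmod v)\<^sup>2 = ((cmod u)\<^sup>2 - (cmod (u - p * v))\<^sup>2) / p"
    using assms by (simp add: field_simps)
  show "2 * Re (cnj v * u) - p * (cmod v)\<^sup>2 \<le> (cmod u)\<^sup>2 / p"
    unfolding eq using assms by (intro divide_right_mono) auto
  show "2 * Re (cnj v * u) - p * (cmod v)\<^sup>2 = (cmod u)\<^sup>2 / p" if "v = u / p"
    unfolding eq using assms that by simp
qed

lemma ent_kernel_resolvent:
  assumes "l \<ge> 0" "m > 0" "t > 0"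
  shows "c * (m * ent_kernel (l / m) t)
    = (t * (l * c) + m * c) / (1 + t)\<^sup>2 - m * c + m\<^sup>2 * t * (c / (l + m * t))"
proof -
  have "m * (t / (l / m + t)) = m\<^sup>2 * t * (1 / (l + m * t))"
  proof -
    have "l / m + t = (l + m * t) / m" using assms by (simp add: field_simps)
    then show ?thesis using assms by (simp add: power2_eq_square)
  qed
  moreover have "m * ((l / m * t + 1) / (1 + t)\<^sup>2) = (t * l + m) / (1 + t)\<^sup>2"
    using assms by (simp add: field_simps)
  moreover have "m * ent_kernel (l / m) t
      = m * ((l / m * t + 1) / (1 + t)\<^sup>2) - m + m * (t / (l / m + t))"
    using assms by (subst ent_kernel_eq(1)) (auto simp: algebra_simps)
  ultimately have eq: "m * ent_kernel (l / m) t
      = (t * l + m) / (1 + t)\<^sup>2 - m + m\<^sup>2 * t * (1 / (l + m * t))" by simp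
  show ?thesis unfolding eq by (simp add: algebra_simps add_divide_distrib)
qed

lemma resolvent_slice_ge:
  assumes B: "is_eigenbasis A B" "countable B" and A: "positive_op A" and m: "m > 0" and t: "t > 0"
  shows "ennreal (resolvent_bound A b m t y) \<le> resolvent_slice A B b m t"
  unfolding resolvent_slice_def
proof (rule has_sum_le_nn_integral[OF B(2) resolvent_bound_has_sum[OF B(1) A]])
  fix a
  have l: "eigval A a \<ge> 0" by (rule eigval_nonneg[OF A])
  then have p: "eigval A a + m * t > 0" using m t by (simp add: add_nonneg_pos)
  have "2 * Re (cinner y a * cinner a b) - eigval A a * (cmod (cinner a y))\<^sup>2
      - m * t * (cmod (cinner a y))\<^sup>2 \<le> (cmod (cinner a b))\<^sup>2 / (eigval A a + m * t)"
    using complete_square(1)[OF p, of "cinner a y" "cinner a b"] cinner_commute[of y a]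
    by (simp add: algebra_simps)
  then show "(t * (eigval A a * (cmod (cinner a b))\<^sup>2) + m * (cmod (cinner a b))\<^sup>2) / (1 + t)\<^sup>2
       - m * (cmod (cinner a b))\<^sup>2
       + m\<^sup>2 * t * (2 * Re (cinner y a * cinner a b) - eigval A a * (cmod (cinner a y))\<^sup>2
           - m * t * (cmod (cinner a y))\<^sup>2)
      \<le> (cmod (cinner a b))\<^sup>2 * (m * ent_kernel (eigval A a / m) t)"
    unfolding ent_kernel_resolvent[OF l m t] using m t by (intro add_left_mono mult_left_mono) auto
qed

text \<open>The maximizer is y = (A + m t)^(-1) b, built from its coefficients in the eigenbasis;
  they are square-summable because all denominators are at least m t > 0.\<close>

lemma resolvent_slice_eq:
  assumes B: "is_eigenbasis A B" "countable B" and A: "positive_op A" and m: "m > 0" and t: "t > 0"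
  obtains y where "resolvent_slice A B b m t = ennreal (resolvent_bound A b m t y)"
proof -
  have on: "orthonormal B" using B by (simp add: is_eigenbasis_def is_onb_iff)
  define c where "c a = cinner a b / complex_of_real (eigval A a + m * t)" for a
  have p: "eigval A a + m * t \<ge> m * t" "m * t > 0" for a
    using m t eigval_nonneg[OF A, of a] by auto
  have "(\<Sum>a\<in>F. (cmod (c a))\<^sup>2) \<le> (norm b)\<^sup>2 / (m * t)\<^sup>2" if F: "finite F" "F \<subseteq> B" for F
  proof -
    have "(\<Sum>a\<in>F. (cmod (c a))\<^sup>2) \<le> (\<Sum>a\<in>F. (cmod (cinner a b))\<^sup>2 / (m * t)\<^sup>2)"
    proof (rule sum_mono)
      fix a
      have "(m * t)\<^sup>2 \<le> (eigval A a + m * t)\<^sup>2" using p(1)[of a] p(2) by (intro power_mono) auto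
      then show "(cmod (c a))\<^sup>2 \<le> (cmod (cinner a b))\<^sup>2 / (m * t)\<^sup>2"
        unfolding c_def norm_divide power_divide norm_of_real power2_abs
        using p(2) by (intro divide_left_mono mult_pos_pos) auto
    qed
    also have "\<dots> \<le> (norm b)\<^sup>2 / (m * t)\<^sup>2"
      unfolding sum_divide_distrib[symmetric] by (intro divide_right_mono bessel[OF on F]) simp
    finally show ?thesis .
  qed
  then obtain y where y: "\<And>a. a \<in> B \<Longrightarrow> cinner a y = c a"
    using orthonormal_has_sum[OF on] by metis
  have "((\<lambda>a. (cmod (cinner a b))\<^sup>2 * (m * ent_kernel (eigval A a / m) t)) has_sum
      resolvent_bound A b m t y) B"
  proof (rule has_sum_cong[THEN iffD1, OF _ resolvent_bound_has_sum[OF B(1) A]])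
    fix a assume a: "a \<in> B"
    have pos: "eigval A a + m * t > 0" using p(1)[of a] p(2) by linarith
    have "2 * Re (cinner y a * cinner a b) - eigval A a * (cmod (cinner a y))\<^sup>2
        - m * t * (cmod (cinner a y))\<^sup>2 = (cmod (cinner a b))\<^sup>2 / (eigval A a + m * t)"
      using complete_square(2)[OF pos y[OF a, unfolded c_def]] cinner_commute[of y a]
      by (simp add: algebra_simps)
    then show "(t * (eigval A a * (cmod (cinner a b))\<^sup>2) + m * (cmod (cinner a b))\<^sup>2) / (1 + t)\<^sup>2
       - m * (cmod (cinner a b))\<^sup>2
       + m\<^sup>2 * t * (2 * Re (cinner y a * cinner a b) - eigval A a * (cmod (cinner a y))\<^sup>2
           - m * t * (cmod (cinner a y))\<^sup>2)
      = (cmod (cinner a b))\<^sup>2 * (m * ent_kernel (eigval A a / m) t)"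
      unfolding ent_kernel_resolvent[OF eigval_nonneg[OF A] m t] by simp
  qed
  then have "resolvent_slice A B b m t = ennreal (resolvent_bound A b m t y)"
    unfolding resolvent_slice_def
    using m t eigval_nonneg[OF A] by (intro nn_integral_has_sum[OF B(2)]) (auto simp: ent_kernel_nonneg)
  then show thesis using that by blast
qed

text \<open>The vector y is optimal for the limit and kept fixed along the sequence, where it still
  gives a lower bound. Since \<open>resolvent_bound\<close> mentions no eigenbasis, the bases
  \<open>B n\<close> may vary arbitrarily.\<close>

lemma resolvent_slice_lsc:
  fixes \<rho> :: "nat \<Rightarrow> 'a::complex_hilbert \<Rightarrow> 'a"
  assumes B: "\<And>n. is_eigenbasis (\<rho> n) (B n)" "\<And>n. countable (B n)" "\<And>n. positive_op (\<rho> n)"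
    and B': "is_eigenbasis \<rho>' B'" "countable B'" "positive_op \<rho>'"
    and wk: "\<And>x y. (\<lambda>n. cinner x (\<rho> n y)) \<longlonglongrightarrow> cinner x (\<rho>' y)"
    and m: "m > 0" and t: "t > 0"
  shows "resolvent_slice \<rho>' B' b m t \<le> liminf (\<lambda>n. resolvent_slice (\<rho> n) (B n) b m t)"
proof -
  obtain y where y: "resolvent_slice \<rho>' B' b m t = ennreal (resolvent_bound \<rho>' b m t y)"
    using resolvent_slice_eq[OF B' m t] by blast
  have "(\<lambda>n. ennreal (resolvent_bound (\<rho> n) b m t y)) \<longlonglongrightarrow> ennreal (resolvent_bound \<rho>' b m t y)"
    unfolding resolvent_bound_def eigval_def
    using t by (intro tendsto_ennrealI tendsto_intros wk) auto
  then have "ennreal (resolvent_bound \<rho>' b m t y) = liminf (\<lambda>n. ennreal (resolvent_bound (\<rho> n) b m t y))"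
    by (intro lim_imp_Liminf[symmetric]) auto
  also have "\<dots> \<le> liminf (\<lambda>n. resolvent_slice (\<rho> n) (B n) b m t)"
    by (intro Liminf_mono always_eventually allI resolvent_slice_ge B m t)
  finally show ?thesis using y by simp
qed

lemma entropy_slice_lsc:
  fixes \<rho> :: "nat \<Rightarrow> 'a::complex_hilbert \<Rightarrow> 'a"
  assumes B: "\<And>n. is_eigenbasis (\<rho> n) (B n)" "\<And>n. countable (B n)" "\<And>n. positive_op (\<rho> n)"
    and B': "is_eigenbasis \<rho>' B'" "countable B'" "positive_op \<rho>'"
    and wk: "\<And>x y. (\<lambda>n. cinner x (\<rho> n y)) \<longlonglongrightarrow> cinner x (\<rho>' y)"
    and m: "m > 0"
  shows "entropy_slice \<rho>' B' b m \<le> liminf (\<lambda>n. entropy_slice (\<rho> n) (B n) b m)"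
proof -
  let ?h = "\<lambda>n t. resolvent_slice (\<rho> n) (B n) b m t * indicator {0<..} t"
  have meas: "?h n \<in> borel_measurable lborel" for n
    using borel_measurable_resolvent_slice[OF B(2)[of n], of "\<rho> n" b m] by measurable
  have "entropy_slice \<rho>' B' b m \<le> (\<integral>\<^sup>+t. liminf (\<lambda>n. ?h n t) \<partial>lborel)"
    unfolding entropy_slice_eq_integral[OF B'(3,2) m]
  proof (intro nn_integral_mono)
    fix t :: real
    show "resolvent_slice \<rho>' B' b m t * indicator {0<..} t \<le> liminf (\<lambda>n. ?h n t)"
      using resolvent_slice_lsc[OF B B' wk m, of t b] by (cases "t > 0") auto
  qed
  also have "\<dots> \<le> liminf (\<lambda>n. \<integral>\<^sup>+t. ?h n t \<partial>lborel)" by (rule nn_integral_liminf[OF meas])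
  also have "\<dots> = liminf (\<lambda>n. entropy_slice (\<rho> n) (B n) b m)"
    unfolding entropy_slice_eq_integral[OF B(3,2) m] ..
  finally show ?thesis .
qed

text \<open>The case m = 0, outside the integral formula: a vector in the kernel overlaps only with
  eigenvectors of eigenvalue 0, so every summand vanishes.\<close>

lemma entropy_slice_zero:
  assumes B: "is_eigenbasis A B" and A: "positive_op A" and b: "A b = 0"
  shows "entropy_slice A B b 0 = 0"
proof -
  have "(cmod (cinner a b))\<^sup>2 * rel_ent (eigval A a) 0 = 0" if "a \<in> B" for a
    using cinner_eigenvector[OF B A that, of b] b by (auto simp: rel_ent_def cinner.zero_right)
  then have "entropy_slice A B b 0 = (\<integral>\<^sup>+a. 0 \<partial>count_space B)"
    unfolding entropy_slice_def by (intro nn_integral_cong) (simp only: space_count_space ennreal_0)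
  then show ?thesis by simp
qed

text \<open>Truncation spoils additivity for mixed signs; this inequality is what the trace bound
  uses, without settling the sign of the entropy summands.\<close>

lemma ennreal_add_subadditive: "ennreal (x + y) \<le> ennreal x + ennreal y"
  by (auto simp: ennreal_plus_if ennreal_neg intro!: ennreal_leI)

section \<open>Trace bound and lower semicontinuity of \<open>QKL\<close>\<close>

context separable_hilbert
begin

lemma QKL_eq:
  fixes \<rho> :: "'a \<Rightarrow> 'a"
  assumes "\<rho> \<in> positive_trace_class" "\<rho>\<^sub>0 \<in> positive_trace_class" "{x. \<rho>\<^sub>0 x = 0} \<subseteq> {x. \<rho> x = 0}"
  shows "QKL \<rho> \<rho>\<^sub>0 = enn2ereal (\<integral>\<^sup>+(a, b). ennreal ((cmod (cinner a b))\<^sup>2 *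
      rel_ent (eigval \<rho> a) (eigval \<rho>\<^sub>0 b)) \<partial>count_space (some_eigenbasis \<rho> \<times> some_eigenbasis \<rho>\<^sub>0))"
proof -
  have "countable (some_eigenbasis \<rho>)" "countable (some_eigenbasis \<rho>\<^sub>0)"
    using is_eigenbasis_some_eigenbasis[OF assms(1)] is_eigenbasis_some_eigenbasis[OF assms(2)]
    by (auto simp: is_eigenbasis_def intro: countable_onb)
  then show ?thesis
    using assms unfolding QKL_def by (simp add: infsum_eq_nn_integral rel_ent_def Let_def)
qed

text \<open>By Parseval the squared overlaps of two orthonormal bases form a doubly stochastic
  matrix; summing out one index leaves the weights of the other.\<close>

lemma nn_integral_overlap:
  assumes "is_onb (B :: 'a set)" "is_onb B'" and c: "\<And>a. a \<in> B \<Longrightarrow> c a \<ge> 0"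
  shows "(\<integral>\<^sup>+(a, b). ennreal ((cmod (cinner a b))\<^sup>2 * c a) \<partial>count_space (B \<times> B'))
    = (\<integral>\<^sup>+a. ennreal (c a) \<partial>count_space B)"
proof -
  have "(\<integral>\<^sup>+b. ennreal ((cmod (cinner a b))\<^sup>2 * c a) \<partial>count_space B') = ennreal (c a)" if "a \<in> B" for a
  proof -
    have "((\<lambda>b. (cmod (cinner a b))\<^sup>2 * c a) has_sum (norm a)\<^sup>2 * c a) B'"
      unfolding cmod_cinner_commute[of a] by (rule has_sum_cmult_left[OF parseval[OF assms(2)]])
    moreover have "norm a = 1" using that assms(1) by (simp add: is_onb_def)
    ultimately show ?thesis
      using nn_integral_has_sum[OF countable_onb[OF assms(2)], of "\<lambda>b. (cmod (cinner a b))\<^sup>2 * c a"]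
        c[OF that] by simp
  qed
  then show ?thesis
    unfolding nn_integral_count_space_fst[OF countable_onb[OF assms(1)] countable_onb[OF assms(2)],
        of "\<lambda>a b. ennreal ((cmod (cinner a b))\<^sup>2 * c a)"]
    by (intro nn_integral_cong) simp
qed

lemma nn_integral_overlap':
  assumes "is_onb (B :: 'a set)" "is_onb B'" and c: "\<And>b. b \<in> B' \<Longrightarrow> c b \<ge> 0"
  shows "(\<integral>\<^sup>+(a, b). ennreal ((cmod (cinner a b))\<^sup>2 * c b) \<partial>count_space (B \<times> B'))
    = (\<integral>\<^sup>+b. ennreal (c b) \<partial>count_space B')"
proof -
  have cn: "countable B" "countable B'" using assms countable_onb by auto
  have "(\<integral>\<^sup>+(a, b). ennreal ((cmod (cinner a b))\<^sup>2 * c b) \<partial>count_space (B \<times> B'))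
      = (\<integral>\<^sup>+(b, a). ennreal ((cmod (cinner b a))\<^sup>2 * c b) \<partial>count_space (B' \<times> B))"
    unfolding nn_integral_count_space_snd[OF cn, of "\<lambda>a b. ennreal ((cmod (cinner a b))\<^sup>2 * c b)"]
      nn_integral_count_space_fst[OF cn(2,1), of "\<lambda>b a. ennreal ((cmod (cinner b a))\<^sup>2 * c b)"]
    by (simp add: cmod_cinner_commute)
  then show ?thesis using nn_integral_overlap[OF assms(2,1) c] by simp
qed

text \<open>The scalar bound \<open>rel_ent_lower_bound\<close> is summed against the doubly
  stochastic overlaps, whose marginals produce the traces of both operators.\<close>

lemma QKL_trace_bound:
  fixes \<rho> :: "'a \<Rightarrow> 'a"
  assumes le: "QKL \<rho> \<rho>\<^sub>0 \<le> ereal C" and M: "trace_le \<rho>\<^sub>0 M"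
  shows "trace_le \<rho> ((exp 1 - 1) * M + C)"
proof -
  have cond: "\<rho> \<in> positive_trace_class" "\<rho>\<^sub>0 \<in> positive_trace_class" "{x. \<rho>\<^sub>0 x = 0} \<subseteq> {x. \<rho> x = 0}"
    using le by (auto simp: QKL_def split: if_splits)
  define B B0 where "B = some_eigenbasis \<rho>" and "B0 = some_eigenbasis \<rho>\<^sub>0"
  have eb: "is_eigenbasis \<rho> B" "is_eigenbasis \<rho>\<^sub>0 B0"
    using cond by (auto simp: B_def B0_def is_eigenbasis_some_eigenbasis)
  have onb: "is_onb B" "is_onb B0" using eb by (auto simp: is_eigenbasis_def)
  have pos: "positive_op \<rho>" "positive_op \<rho>\<^sub>0" using cond by (auto simp: positive_trace_class_iff)
  have C0: "C \<ge> 0" using order_trans[OF QKL_nonneg le] by simp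
  have K0: "exp 1 - (1::real) \<ge> 0" by simp
  let ?r = "\<lambda>a b. (cmod (cinner a b))\<^sup>2 * rel_ent (eigval \<rho> a) (eigval \<rho>\<^sub>0 b)"
  have Q: "(\<integral>\<^sup>+(a, b). ennreal (?r a b) \<partial>count_space (B \<times> B0)) \<le> ennreal C"
    using le C0 unfolding QKL_eq[OF cond] B_def[symmetric] B0_def[symmetric]
    by (simp add: ennreal.rep_eq less_eq_ennreal.rep_eq max_def)
  have "(\<integral>\<^sup>+a. ennreal (eigval \<rho> a) \<partial>count_space B)
      = (\<integral>\<^sup>+(a, b). ennreal ((cmod (cinner a b))\<^sup>2 * eigval \<rho> a) \<partial>count_space (B \<times> B0))"
    using nn_integral_overlap[OF onb] eigval_nonneg[OF pos(1)] by simp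
  also have "\<dots> \<le> (\<integral>\<^sup>+(a, b). ennreal ((cmod (cinner a b))\<^sup>2 * ((exp 1 - 1) * eigval \<rho>\<^sub>0 b)) +
      ennreal (?r a b) \<partial>count_space (B \<times> B0))"
  proof (rule nn_integral_mono, clarsimp)
    fix a b assume ab: "a \<in> B" "b \<in> B0"
    have l: "eigval \<rho> a \<ge> 0" and m: "eigval \<rho>\<^sub>0 b \<ge> 0" using eigval_nonneg pos by auto
    have "(cmod (cinner a b))\<^sup>2 * eigval \<rho> a \<le> (cmod (cinner a b))\<^sup>2 * ((exp 1 - 1) * eigval \<rho>\<^sub>0 b) + ?r a b"
    \<comment> \<open>The scalar bound needs a positive second argument. At eigenvalue 0 the kernel
      condition gives \<rho> b = 0, so the eigenvalue of \<rho> at a or its overlap with b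
      vanishes.\<close>
    proof (cases "eigval \<rho>\<^sub>0 b = 0")
      case True
      then have "\<rho>\<^sub>0 b = 0" using eigenbasis_eigval[OF eb(2) pos(2) ab(2)] by (simp add: scaleC.zero_left)
      then have "\<rho> b = 0" using cond(3) by blast
      then have "eigval \<rho> a * (cmod (cinner a b))\<^sup>2 = 0"
        using cinner_eigenvector[OF eb(1) pos(1) ab(1), of b] by (auto simp: cinner.zero_right)
      then show ?thesis using True by (auto simp: rel_ent_def)
    next
      case False
      then show ?thesis
        unfolding ring_distribs(1)[symmetric] using l m
        by (intro mult_left_mono rel_ent_lower_bound) auto
    qed
    then have "ennreal ((cmod (cinner a b))\<^sup>2 * eigval \<rho> a)
        \<le> ennreal ((cmod (cinner a b))\<^sup>2 * ((exp 1 - 1) * eigval \<rho>\<^sub>0 b) + ?r a b)"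
      by (rule ennreal_leI)
    also have "\<dots> \<le> ennreal ((cmod (cinner a b))\<^sup>2 * ((exp 1 - 1) * eigval \<rho>\<^sub>0 b)) + ennreal (?r a b)"
      by (rule ennreal_add_subadditive)
    finally show "ennreal ((cmod (cinner a b))\<^sup>2 * eigval \<rho> a)
        \<le> ennreal ((cmod (cinner a b))\<^sup>2 * ((exp 1 - 1) * eigval \<rho>\<^sub>0 b)) + ennreal (?r a b)" .
  qed
  also have "\<dots> = (\<integral>\<^sup>+(a, b). ennreal ((cmod (cinner a b))\<^sup>2 * ((exp 1 - 1) * eigval \<rho>\<^sub>0 b)) \<partial>count_space (B \<times> B0))
      + (\<integral>\<^sup>+(a, b). ennreal (?r a b) \<partial>count_space (B \<times> B0))"
    unfolding case_prod_unfold by (rule nn_integral_add) auto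
  also have "\<dots> \<le> ennreal ((exp 1 - 1) * M) + ennreal C"
  proof (rule add_mono[OF _ Q])
    have "(\<integral>\<^sup>+b. ennreal ((exp 1 - 1) * eigval \<rho>\<^sub>0 b) \<partial>count_space B0) \<le> ennreal ((exp 1 - 1) * M)"
    proof (rule nn_integral_le_finite_sums[OF countable_onb[OF onb(2)]])
      fix F assume F: "finite F" "F \<subseteq> B0"
      then have "sum (eigval \<rho>\<^sub>0) F \<le> M"
        using M orthonormal_subset[of B0 F] onb(2) by (auto simp: trace_le_def is_onb_iff)
      then show "(\<Sum>b\<in>F. (exp 1 - 1) * eigval \<rho>\<^sub>0 b) \<le> (exp 1 - 1) * M"
        unfolding sum_distrib_left[symmetric] using K0 by (rule mult_left_mono)
    qed (use eigval_nonneg[OF pos(2)] in simp)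
    then show "(\<integral>\<^sup>+(a, b). ennreal ((cmod (cinner a b))\<^sup>2 * ((exp 1 - 1) * eigval \<rho>\<^sub>0 b)) \<partial>count_space (B \<times> B0))
        \<le> ennreal ((exp 1 - 1) * M)"
      using nn_integral_overlap'[OF onb, of "\<lambda>b. (exp 1 - 1) * eigval \<rho>\<^sub>0 b"] eigval_nonneg[OF pos(2)]
      by simp
  qed
  also have "\<dots> = ennreal ((exp 1 - 1) * M + C)"
    using C0 trace_le_nonneg[OF M] by simp
  finally have total: "(\<integral>\<^sup>+a. ennreal (eigval \<rho> a) \<partial>count_space B) \<le> ennreal ((exp 1 - 1) * M + C)" .
  show ?thesis
  proof (rule trace_leI[OF eb(1) pos(1)])
    fix F assume F: "finite F" "F \<subseteq> B"
    have "ennreal (sum (eigval \<rho>) F) = (\<Sum>a\<in>F. ennreal (eigval \<rho> a))"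
      using eigval_nonneg[OF pos(1)] by simp
    also have "\<dots> \<le> (\<integral>\<^sup>+a. ennreal (eigval \<rho> a) \<partial>count_space B)"
      by (rule sum_le_nn_integral_count_space[OF countable_onb[OF onb(1)] F])
    finally have "ennreal (sum (eigval \<rho>) F) \<le> ennreal ((exp 1 - 1) * M + C)"
      using total by (rule order_trans)
    then show "sum (eigval \<rho>) F \<le> (exp 1 - 1) * M + C"
    proof (rule iffD1[OF ennreal_le_iff, rotated])
      show "0 \<le> (exp 1 - 1) * M + C" using C0 trace_le_nonneg[OF M] by simp
    qed
  qed
qed

text \<open>The sum over the fixed eigenbasis of \<open>\<rho>\<^sub>0\<close> is taken outermost,
  so that Fatou's lemma applies to it after the slices have been treated one by one.\<close>

lemma QKL_lsc:
  fixes \<rho> :: "nat \<Rightarrow> 'a \<Rightarrow> 'a"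
  assumes le: "\<And>n. QKL (\<rho> n) \<rho>\<^sub>0 \<le> ereal C" and \<rho>': "\<rho>' \<in> positive_trace_class"
    and wk: "\<And>x y. (\<lambda>n. cinner x (\<rho> n y)) \<longlonglongrightarrow> cinner x (\<rho>' y)"
  shows "QKL \<rho>' \<rho>\<^sub>0 \<le> ereal C"
proof -
  have cond: "\<rho> n \<in> positive_trace_class" "\<rho>\<^sub>0 \<in> positive_trace_class" "{x. \<rho>\<^sub>0 x = 0} \<subseteq> {x. \<rho> n x = 0}" for n
    using le[of n] by (auto simp: QKL_def split: if_splits)
  have C0: "C \<ge> 0" using order_trans[OF QKL_nonneg le[of 0]] by simp
  \<comment> \<open>If every member of the sequence kills x, then so does the weak limit; otherwise
    \<open>QKL\<close> could jump to infinity.\<close>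
  have ker: "{x. \<rho>\<^sub>0 x = 0} \<subseteq> {x. \<rho>' x = 0}"
  proof safe
    fix x assume "\<rho>\<^sub>0 x = 0"
    then have "\<rho> n x = 0" for n using cond(3)[of n] by blast
    then have "cinner y (\<rho>' x) = 0" for y
      using wk[of y x] by (simp add: cinner.zero_right LIMSEQ_const_iff)
    then show "\<rho>' x = 0" using cinner_eq_zero_iff by blast
  qed
  have pos: "positive_op (\<rho> n)" "positive_op \<rho>'" "positive_op \<rho>\<^sub>0" for n
    using cond \<rho>' by (auto simp: positive_trace_class_iff)
  define B where "B A = some_eigenbasis A" for A :: "'a \<Rightarrow> 'a"
  have eb: "is_eigenbasis (\<rho> n) (B (\<rho> n))" "is_eigenbasis \<rho>' (B \<rho>')" "is_eigenbasis \<rho>\<^sub>0 (B \<rho>\<^sub>0)" for n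
    using cond \<rho>' by (auto simp: B_def is_eigenbasis_some_eigenbasis)
  then have cn: "countable (B (\<rho> n))" "countable (B \<rho>')" "countable (B \<rho>\<^sub>0)" for n
    by (auto simp: is_eigenbasis_def intro: countable_onb)
  let ?q = "\<lambda>A b. entropy_slice A (B A) b (eigval \<rho>\<^sub>0 b)"
  have Q: "QKL A \<rho>\<^sub>0 = enn2ereal (\<integral>\<^sup>+b. ?q A b \<partial>count_space (B \<rho>\<^sub>0))"
    if "A \<in> positive_trace_class" "{x. \<rho>\<^sub>0 x = 0} \<subseteq> {x. A x = 0}" "countable (B A)" for A
    unfolding QKL_eq[OF that(1) cond(2) that(2)] B_def[symmetric] entropy_slice_def
    by (subst nn_integral_count_space_snd[OF that(3) cn(3)]) rule
  have "(\<integral>\<^sup>+b. ?q \<rho>' b \<partial>count_space (B \<rho>\<^sub>0)) \<le> (\<integral>\<^sup>+b. liminf (\<lambda>n. ?q (\<rho> n) b) \<partial>count_space (B \<rho>\<^sub>0))"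
  proof (intro nn_integral_mono)
    fix b assume "b \<in> space (count_space (B \<rho>\<^sub>0))"
    then have b: "b \<in> B \<rho>\<^sub>0" by simp
    show "?q \<rho>' b \<le> liminf (\<lambda>n. ?q (\<rho> n) b)"
    \<comment> \<open>In the kernel of \<open>\<rho>\<^sub>0\<close> the slice of the limit is 0 and
      nothing needs to converge.\<close>
    proof (cases "eigval \<rho>\<^sub>0 b = 0")
      case True
      then have "\<rho>\<^sub>0 b = 0" using eigenbasis_eigval[OF eb(3) pos(3) b] by (simp add: scaleC.zero_left)
      then have "\<rho>' b = 0" using ker by blast
      then show ?thesis using entropy_slice_zero[OF eb(2) pos(2)] True by simp
    next
      case False
      then have "eigval \<rho>\<^sub>0 b > 0" using eigval_nonneg[OF pos(3), of b] by linarith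
      then show ?thesis using entropy_slice_lsc[OF eb(1) cn(1) pos(1) eb(2) cn(2) pos(2) wk] by blast
    qed
  qed
  also have "\<dots> \<le> liminf (\<lambda>n. \<integral>\<^sup>+b. ?q (\<rho> n) b \<partial>count_space (B \<rho>\<^sub>0))"
    by (rule nn_integral_liminf) simp
  also have "\<dots> \<le> liminf (\<lambda>n. ennreal C)"
  proof (intro Liminf_mono always_eventually allI)
    fix n
    show "(\<integral>\<^sup>+b. ?q (\<rho> n) b \<partial>count_space (B \<rho>\<^sub>0)) \<le> ennreal C"
      using le[of n] C0 unfolding Q[OF cond(1,3) cn(1)]
      by (simp add: ennreal.rep_eq less_eq_ennreal.rep_eq max_def)
  qed
  also have "\<dots> = ennreal C" by (simp add: Liminf_const)
  finally show ?thesis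
    using C0 unfolding Q[OF \<rho>' ker cn(2)]
    by (simp add: ennreal.rep_eq less_eq_ennreal.rep_eq max_def)
qed

end

theorem theorem2p7:
  fixes \<rho>\<^sub>0 :: "'a::complex_hilbert \<Rightarrow> 'a"
  assumes separable: "\<exists>D::'a set. countable D \<and> closure D = UNIV"
    and "\<rho>\<^sub>0 \<in> positive_trace_class"
  shows "seq_lower_semicompact weak_star (\<lambda>\<rho>. QKL \<rho> \<rho>\<^sub>0)"
  unfolding seq_lower_semicompact_def seq_compactin_def
proof (intro allI conjI impI)
  obtain D :: "'a set" where "countable D" "closure D = UNIV" using separable by blast
  then interpret separable_hilbert D by unfold_locales
  obtain M\<^sub>0 where M\<^sub>0: "trace_le \<rho>\<^sub>0 M\<^sub>0"
    using trace_le_exists[OF is_eigenbasis_some_eigenbasis[OF assms(2)] assms(2)] by blast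
  fix C :: real and f :: "nat \<Rightarrow> 'a \<Rightarrow> 'a"
  assume "range f \<subseteq> {\<rho> \<in> topspace weak_star. QKL \<rho> \<rho>\<^sub>0 \<le> ereal C}"
  then have le: "QKL (f n) \<rho>\<^sub>0 \<le> ereal C" for n by blast
  then have M: "trace_le (f n) ((exp 1 - 1) * M\<^sub>0 + C)" for n by (rule QKL_trace_bound[OF _ M\<^sub>0])
  \<comment> \<open>Weak operator convergence along this one subsequence feeds both remaining
    claims: weak-star convergence and the entropy bound for the limit.\<close>
  obtain r l where r: "strict_mono (r :: nat \<Rightarrow> nat)" and l: "trace_le l ((exp 1 - 1) * M\<^sub>0 + C)"
    and wk: "\<And>x y. (\<lambda>n. cinner x (f (r n) y)) \<longlonglongrightarrow> cinner x (l y)"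
    by (rule trace_le_compact[of f, OF M]) (rule that)
  have tc: "l \<in> trace_class" "f n \<in> trace_class" for n
    using trace_le_positive_trace_class[OF l] trace_le_positive_trace_class[OF M]
    by (auto simp: positive_trace_class_def)
  have "QKL l \<rho>\<^sub>0 \<le> ereal C"
    by (rule QKL_lsc[of "\<lambda>n. f (r n)", OF le trace_le_positive_trace_class[OF l] wk])
  moreover have "limitin weak_star (f \<circ> r) l sequentially"
  proof (rule limitin_weak_star)
    show "(\<lambda>n. tr ((f \<circ> r) n \<circ> S)) \<longlonglongrightarrow> tr (l \<circ> S)" if "S \<in> compact_ops" for S
      unfolding comp_def[of f r]
      by (rule tr_tendsto[OF trace_le_eigenbasis[OF M] trace_le_eigenbasis[OF l] M l wk that])
  qed (use tc in simp_all)
  ultimately show "\<exists>l\<in>{\<rho> \<in> topspace weak_star. QKL \<rho> \<rho>\<^sub>0 \<le> ereal C}.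
      \<exists>r. strict_mono r \<and> limitin weak_star (f \<circ> r) l sequentially"
    using r tc(1) by (auto simp: topspace_weak_star)
qed auto

end
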